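(* Let $k$ be a field, $C$ a coalgebra over $k$, $I$ a coideal of $C$ and $\sigma:C\otimes C/I\to k$ a ${\cal D}$-map. Let $(M,\rho)$ be a right $C$-comodule. Then the map $$R_\sigma:M\otimes M\to M\otimes M,\quad R_\sigma(m\otimes n)=\sum\sigma(m_{<1>}\otimes\overline{n_{<1>}})\,m_{<0>}\otimes n_{<0>}$$ is a solution of the ${\cal D}$-equation, i.e. $R_\sigma^{12}R_\sigma^{23}=R_\sigma^{23}R_\sigma^{12}$ in $\mathrm{End}_k(M\otimes M\otimes M)$.
   Context: All vector spaces and coalgebras are over a field $k$; $\otimes=\otimes_k$. For $R\in\mathrm{End}_k(M\otimes M)$, $R^{12}=R\otimes I$ and $R^{23}=I\otimes R$. For a right $C$-comodule write $\rho(m)=\sum m_{<0>}\otimes m_{<1>}$. For a coideal $I$ of $C$ the class of $c\in C$ in the quotient coalgebra $C/I$ is denoted $\overline{c}$, and $C\otimes C/I$ means $C\otimes(C/I)$. A $k$-linear map $\sigma:C\otimes C/I\to k$ (equivalently, a $k$-bilinear map on $C\times C/I$) is called a ${\cal D}$-map if $$\sum\sigma(c_{(1)}\otimes\overline{d})\,\overline{c_{(2)}}=\sum\sigma(c_{(2)}\otimes\overline{d})\,\overline{c_{(1)}}\quad\text{in } C/I$$ for all $c\in C$, $\overline{d}\in C/I$, where $\Delta(c)=\sum c_{(1)}\otimes c_{(2)}$. *)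

theory Defs
  imports "HOL-Algebra.AbelCoset" "Jordan_Normal_Form.Missing_VectorSpace"
begin

section \<open>Quotients, free vector spaces and tensor products\<close>

text \<open>Vector spaces are the carrier-based ones of the AFP entry VectorSpace
  (\<^locale>\<open>vectorspace\<close>, a HOL-Algebra module over a field). They are records extending rings; the
  multiplicative fields \<open>mult\<close> and \<open>one\<close> play no role and are left unspecified below.\<close>

definition self_space :: "('k, 'r) ring_scheme \<Rightarrow> ('k, 'k) module" where
  "self_space K = \<lparr>carrier = carrier K, mult = mult K, one = \<one>\<^bsub>K\<^esub>, zero = \<zero>\<^bsub>K\<^esub>, add = add K,
     smult = mult K\<rparr>"

definition quot_space :: "('k, 'v, 'z) module_scheme \<Rightarrow> 'v set \<Rightarrow> ('k, 'v set) module" where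
  "quot_space V N = \<lparr>carrier = a_rcosets\<^bsub>V\<^esub> N, mult = undefined, one = undefined, zero = N,
     add = set_add V, smult = (\<lambda>a X. \<Union>x\<in>X. N +>\<^bsub>V\<^esub> (a \<odot>\<^bsub>V\<^esub> x))\<rparr>"

definition free_space :: "('k, 'r) ring_scheme \<Rightarrow> 's set \<Rightarrow> ('k, 's \<Rightarrow> 'k) module" where
  "free_space K S = \<lparr>carrier = {f. f \<in> UNIV \<rightarrow> carrier K \<and> finite {s. f s \<noteq> \<zero>\<^bsub>K\<^esub>} \<and>
       {s. f s \<noteq> \<zero>\<^bsub>K\<^esub>} \<subseteq> S},
     mult = undefined, one = undefined, zero = (\<lambda>s. \<zero>\<^bsub>K\<^esub>),
     add = (\<lambda>f g s. f s \<oplus>\<^bsub>K\<^esub> g s), smult = (\<lambda>a f s. a \<otimes>\<^bsub>K\<^esub> f s)\<rparr>"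

definition free_gen :: "('k, 'r) ring_scheme \<Rightarrow> 's \<Rightarrow> 's \<Rightarrow> 'k" where
  "free_gen K s = (\<lambda>t. if t = s then \<one>\<^bsub>K\<^esub> else \<zero>\<^bsub>K\<^esub>)"

definition tensor_rels :: "('k, 'r) ring_scheme \<Rightarrow> ('k, 'v, 'y) module_scheme \<Rightarrow>
    ('k, 'w, 'z) module_scheme \<Rightarrow> ('v \<times> 'w \<Rightarrow> 'k) set" where
  "tensor_rels K V W =
    (let F = free_space K (carrier V \<times> carrier W); \<delta> = (\<lambda>v w. free_gen K (v, w)) in
      {\<delta> (v \<oplus>\<^bsub>V\<^esub> v') w \<ominus>\<^bsub>F\<^esub> (\<delta> v w \<oplus>\<^bsub>F\<^esub> \<delta> v' w) | v v' w.
         v \<in> carrier V \<and> v' \<in> carrier V \<and> w \<in> carrier W} \<union>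
      {\<delta> v (w \<oplus>\<^bsub>W\<^esub> w') \<ominus>\<^bsub>F\<^esub> (\<delta> v w \<oplus>\<^bsub>F\<^esub> \<delta> v w') | v w w'.
         v \<in> carrier V \<and> w \<in> carrier W \<and> w' \<in> carrier W} \<union>
      {\<delta> (a \<odot>\<^bsub>V\<^esub> v) w \<ominus>\<^bsub>F\<^esub> a \<odot>\<^bsub>F\<^esub> \<delta> v w | a v w.
         a \<in> carrier K \<and> v \<in> carrier V \<and> w \<in> carrier W} \<union>
      {\<delta> v (a \<odot>\<^bsub>W\<^esub> w) \<ominus>\<^bsub>F\<^esub> a \<odot>\<^bsub>F\<^esub> \<delta> v w | a v w.
         a \<in> carrier K \<and> v \<in> carrier V \<and> w \<in> carrier W})"

definition tensor_null :: "('k, 'r) ring_scheme \<Rightarrow> ('k, 'v, 'y) module_scheme \<Rightarrow>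
    ('k, 'w, 'z) module_scheme \<Rightarrow> ('v \<times> 'w \<Rightarrow> 'k) set" where
  "tensor_null K V W = LinearCombinations.module.span K
     (free_space K (carrier V \<times> carrier W)) (tensor_rels K V W)"

definition tensor :: "('k, 'r) ring_scheme \<Rightarrow> ('k, 'v, 'y) module_scheme \<Rightarrow>
    ('k, 'w, 'z) module_scheme \<Rightarrow> ('k, ('v \<times> 'w \<Rightarrow> 'k) set) module" where
  "tensor K V W = quot_space (free_space K (carrier V \<times> carrier W)) (tensor_null K V W)"

definition tens :: "('k, 'r) ring_scheme \<Rightarrow> ('k, 'v, 'y) module_scheme \<Rightarrow>
    ('k, 'w, 'z) module_scheme \<Rightarrow> 'v \<Rightarrow> 'w \<Rightarrow> ('v \<times> 'w \<Rightarrow> 'k) set" where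
  "tens K V W v w =
     tensor_null K V W +>\<^bsub>free_space K (carrier V \<times> carrier W)\<^esub> free_gen K (v, w)"

definition bilinear_map :: "('k, 'r) ring_scheme \<Rightarrow> ('k, 'v, 'x) module_scheme \<Rightarrow>
    ('k, 'w, 'y) module_scheme \<Rightarrow> ('k, 'p, 'z) module_scheme \<Rightarrow> ('v \<Rightarrow> 'w \<Rightarrow> 'p) \<Rightarrow> bool" where
  "bilinear_map K V W P b \<longleftrightarrow>
     (\<forall>v\<in>carrier V. b v \<in> module_hom K W P) \<and>
     (\<forall>w\<in>carrier W. (\<lambda>v. b v w) \<in> module_hom K V P)"

text \<open>The linear map on \<open>V \<otimes> W\<close> induced by a bilinear map \<open>b\<close> into \<open>P\<close>: write the tensor \<open>X\<close> as a
  finite sum \<open>\<Sum> a\<^sub>i v\<^sub>i \<otimes> w\<^sub>i\<close> and return \<open>\<Sum> a\<^sub>i b(v\<^sub>i, w\<^sub>i)\<close>. For bilinear \<open>b\<close> the chosen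
  representation is irrelevant, by \<open>tensor_lift_coset\<close> below.
  This is also what Sweedler notation means, so a sum \<open>\<Sum> b(c\<^sub>(\<^sub>1\<^sub>), c\<^sub>(\<^sub>2\<^sub>))\<close> is
  \<open>tensor_lift\<close> of \<open>b\<close> applied to \<open>\<Delta> c\<close>.\<close>

definition tensor_lift :: "('k, 'r) ring_scheme \<Rightarrow> ('k, 'v, 'x) module_scheme \<Rightarrow>
    ('k, 'w, 'y) module_scheme \<Rightarrow> ('k, 'p, 'z) module_scheme \<Rightarrow> ('v \<Rightarrow> 'w \<Rightarrow> 'p) \<Rightarrow>
    ('v \<times> 'w \<Rightarrow> 'k) set \<Rightarrow> 'p" where
  "tensor_lift K V W P b X = (let f = (SOME f. f \<in> X) in
     \<Oplus>\<^bsub>P\<^esub>p\<in>{p. f p \<noteq> \<zero>\<^bsub>K\<^esub>}. f p \<odot>\<^bsub>P\<^esub> b (fst p) (snd p))"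

definition tensor_map :: "('k, 'r) ring_scheme \<Rightarrow> ('k, 'v, 'x) module_scheme \<Rightarrow>
    ('k, 'w, 'y) module_scheme \<Rightarrow> ('k, 'v1, 'x1) module_scheme \<Rightarrow>
    ('k, 'w1, 'y1) module_scheme \<Rightarrow> ('v \<Rightarrow> 'v1) \<Rightarrow> ('w \<Rightarrow> 'w1) \<Rightarrow>
    ('v \<times> 'w \<Rightarrow> 'k) set \<Rightarrow> ('v1 \<times> 'w1 \<Rightarrow> 'k) set" where
  "tensor_map K V W V' W' f g =
     tensor_lift K V W (tensor K V' W') (\<lambda>v w. tens K V' W' (f v) (g w))"

text \<open>The associativity isomorphism \<open>(U \<otimes> V) \<otimes> W \<cong> U \<otimes> (V \<otimes> W)\<close> in both directions.\<close>

definition tensor_assoc :: "('k, 'r) ring_scheme \<Rightarrow> ('k, 'u, 'x) module_scheme \<Rightarrow>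
    ('k, 'v, 'y) module_scheme \<Rightarrow> ('k, 'w, 'z) module_scheme \<Rightarrow>
    (('u \<times> 'v \<Rightarrow> 'k) set \<times> 'w \<Rightarrow> 'k) set \<Rightarrow> ('u \<times> ('v \<times> 'w \<Rightarrow> 'k) set \<Rightarrow> 'k) set" where
  "tensor_assoc K U V W = (let P = tensor K U (tensor K V W) in
     tensor_lift K (tensor K U V) W P (\<lambda>t w.
       tensor_lift K U V P (\<lambda>u v. tens K U (tensor K V W) u (tens K V W v w)) t))"

definition tensor_assoc_inv :: "('k, 'r) ring_scheme \<Rightarrow> ('k, 'u, 'x) module_scheme \<Rightarrow>
    ('k, 'v, 'y) module_scheme \<Rightarrow> ('k, 'w, 'z) module_scheme \<Rightarrow>
    ('u \<times> ('v \<times> 'w \<Rightarrow> 'k) set \<Rightarrow> 'k) set \<Rightarrow> (('u \<times> 'v \<Rightarrow> 'k) set \<times> 'w \<Rightarrow> 'k) set" where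
  "tensor_assoc_inv K U V W = (let P = tensor K (tensor K U V) W in
     tensor_lift K U (tensor K V W) P (\<lambda>u t.
       tensor_lift K V W P (\<lambda>v w. tens K (tensor K U V) W (tens K U V u v) w) t))"

text \<open>The image of \<open>A \<otimes> B\<close> in \<open>V \<otimes> W\<close>, for subspaces \<open>A\<close> of \<open>V\<close> and \<open>B\<close> of \<open>W\<close>.\<close>

definition tensor_sub :: "('k, 'r) ring_scheme \<Rightarrow> ('k, 'v, 'x) module_scheme \<Rightarrow>
    ('k, 'w, 'y) module_scheme \<Rightarrow> 'v set \<Rightarrow> 'w set \<Rightarrow> ('v \<times> 'w \<Rightarrow> 'k) set set" where
  "tensor_sub K V W A B = LinearCombinations.module.span K (tensor K V W)
     {tens K V W v w | v w. v \<in> A \<and> w \<in> B}"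


subsection \<open>Basic facts\<close>

lemma free_space_simps:
  "carrier (free_space K S) = {f. f \<in> UNIV \<rightarrow> carrier K \<and> finite {s. f s \<noteq> \<zero>\<^bsub>K\<^esub>} \<and> {s. f s \<noteq> \<zero>\<^bsub>K\<^esub>} \<subseteq> S}"
  "\<zero>\<^bsub>free_space K S\<^esub> = (\<lambda>s. \<zero>\<^bsub>K\<^esub>)"
  "f \<oplus>\<^bsub>free_space K S\<^esub> g = (\<lambda>s. f s \<oplus>\<^bsub>K\<^esub> g s)"
  "a \<odot>\<^bsub>free_space K S\<^esub> f = (\<lambda>s. a \<otimes>\<^bsub>K\<^esub> f s)"
  by (auto simp: free_space_def)

lemma vectorspace_free_space:
  fixes K :: "('k, 'r) ring_scheme" and S :: "'s set"
  assumes "field K" shows "vectorspace K (free_space K S)"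
proof -
  interpret K: field K by fact
  have supp_add: "{s. f s \<oplus>\<^bsub>K\<^esub> g s \<noteq> \<zero>\<^bsub>K\<^esub>} \<subseteq> {s. f s \<noteq> \<zero>\<^bsub>K\<^esub>} \<union> {s. g s \<noteq> \<zero>\<^bsub>K\<^esub>}" for f g :: "'s \<Rightarrow> 'k"
    by auto
  have supp_mul: "{s. a \<otimes>\<^bsub>K\<^esub> f s \<noteq> \<zero>\<^bsub>K\<^esub>} \<subseteq> {s. f s \<noteq> \<zero>\<^bsub>K\<^esub>}" if "a \<in> carrier K" for a and f :: "'s \<Rightarrow> 'k"
    using that by auto
  have add_closed: "f \<oplus>\<^bsub>free_space K S\<^esub> g \<in> carrier (free_space K S)"
    if "f \<in> carrier (free_space K S)" "g \<in> carrier (free_space K S)" for f g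
    using that finite_subset[OF supp_add[of f g]] supp_add[of f g] unfolding free_space_simps by (auto simp: Pi_iff)
  have neg_closed: "(\<lambda>s. \<ominus>\<^bsub>K\<^esub> f s) \<in> carrier (free_space K S)" if "f \<in> carrier (free_space K S)" for f
  proof -
    have "{s. \<ominus>\<^bsub>K\<^esub> f s \<noteq> \<zero>\<^bsub>K\<^esub>} \<subseteq> {s. f s \<noteq> \<zero>\<^bsub>K\<^esub>}" by auto
    thus ?thesis using that finite_subset unfolding free_space_simps by (auto simp: Pi_iff)
  qed
  have ag: "abelian_group (free_space K S)"
  proof (rule abelian_groupI)
    fix x assume x: "x \<in> carrier (free_space K S)"
    show "\<exists>y\<in>carrier (free_space K S). y \<oplus>\<^bsub>free_space K S\<^esub> x = \<zero>\<^bsub>free_space K S\<^esub>"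
      using x neg_closed[OF x] by (intro bexI[of _ "\<lambda>s. \<ominus>\<^bsub>K\<^esub> x s"]) (auto simp: free_space_simps Pi_iff K.l_neg)
  qed (use add_closed in \<open>auto simp: free_space_simps Pi_iff K.a_ac\<close>)
  have "module K (free_space K S)"
  proof (rule moduleI)
    fix a x assume "a \<in> carrier K" "x \<in> carrier (free_space K S)"
    then show "a \<odot>\<^bsub>free_space K S\<^esub> x \<in> carrier (free_space K S)"
      using supp_mul[of a x] finite_subset unfolding free_space_simps by (auto simp: Pi_iff)
  qed (use ag in \<open>auto simp: free_space_simps Pi_iff K.l_distr K.r_distr K.m_assoc K.is_cring\<close>)
  thus ?thesis unfolding vectorspace_def using assms by simp
qed

lemma quot_space_simps:
  "carrier (quot_space V N) = a_rcosets\<^bsub>V\<^esub> N" "\<zero>\<^bsub>quot_space V N\<^esub> = N"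
  "X \<oplus>\<^bsub>quot_space V N\<^esub> Y = X <+>\<^bsub>V\<^esub> Y"
  "a \<odot>\<^bsub>quot_space V N\<^esub> X = (\<Union>x\<in>X. N +>\<^bsub>V\<^esub> (a \<odot>\<^bsub>V\<^esub> x))"
  by (auto simp: quot_space_def)

lemma submodule_abelian_subgroup:
  assumes "submodule K N V" shows "abelian_subgroup N V"
proof -
  interpret N: submodule K N V by fact
  interpret V: module K V by (rule N.module)
  have "subgroup N (add_monoid V)"
  proof (rule group.subgroupI[OF V.M.a_group])
    show "N \<subseteq> carrier (add_monoid V)" using N.subset by simp
    show "N \<noteq> {}" using N.zero_closed by blast
    fix a assume a: "a \<in> N"
    then have "\<ominus>\<^bsub>V\<^esub> a = (\<ominus>\<^bsub>K\<^esub> \<one>\<^bsub>K\<^esub>) \<odot>\<^bsub>V\<^esub> a" using N.subset V.smult_minus_1 by auto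
    with a have "\<ominus>\<^bsub>V\<^esub> a \<in> N" by simp
    thus "inv\<^bsub>add_monoid V\<^esub> a \<in> N" by (simp add: a_inv_def)
  qed auto
  then show ?thesis
    by (intro abelian_subgroupI3 additive_subgroup.intro V.M.abelian_group_axioms)
qed

lemma quot_space_smult_coset:
  assumes "submodule K N V" "a \<in> carrier K" "v \<in> carrier V"
  shows "a \<odot>\<^bsub>quot_space V N\<^esub> (N +>\<^bsub>V\<^esub> v) = N +>\<^bsub>V\<^esub> (a \<odot>\<^bsub>V\<^esub> v)"
proof -
  interpret N: submodule K N V by fact
  interpret V: module K V by (rule N.module)
  interpret A: abelian_subgroup N V by (rule submodule_abelian_subgroup) fact
  have "N +>\<^bsub>V\<^esub> (a \<odot>\<^bsub>V\<^esub> x) = N +>\<^bsub>V\<^esub> (a \<odot>\<^bsub>V\<^esub> v)" if x: "x \<in> N +>\<^bsub>V\<^esub> v" for x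
  proof -
    obtain n where n: "n \<in> N" "x = n \<oplus>\<^bsub>V\<^esub> v" using x by (auto simp: a_r_coset_def')
    have nc: "n \<in> carrier V" using n N.subset by auto
    have "a \<odot>\<^bsub>V\<^esub> x = a \<odot>\<^bsub>V\<^esub> n \<oplus>\<^bsub>V\<^esub> a \<odot>\<^bsub>V\<^esub> v" using n nc assms V.smult_r_distr by simp
    then have "a \<odot>\<^bsub>V\<^esub> x \<in> N +>\<^bsub>V\<^esub> (a \<odot>\<^bsub>V\<^esub> v)" using n(1) assms(2) by (auto simp: a_r_coset_def')
    then show ?thesis using A.a_repr_independence' V.smult_closed assms A.a_subgroup by metis
  qed
  moreover have "N +>\<^bsub>V\<^esub> v \<noteq> {}" using A.a_rcos_self assms by blast
  ultimately show ?thesis unfolding quot_space_simps by (intro SUP_eq_const)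
qed

lemma quot_space_carrierE:
  assumes "X \<in> carrier (quot_space V N)"
  obtains v where "v \<in> carrier V" "X = N +>\<^bsub>V\<^esub> v"
  using assms by (auto simp: quot_space_simps A_RCOSETS_def')

lemma quot_space_coset_closed:
  "v \<in> carrier V \<Longrightarrow> N +>\<^bsub>V\<^esub> v \<in> carrier (quot_space V N)"
  by (auto simp: quot_space_simps A_RCOSETS_def')

lemma quot_space_add_coset:
  assumes "submodule K N V" "v \<in> carrier V" "w \<in> carrier V"
  shows "(N +>\<^bsub>V\<^esub> v) \<oplus>\<^bsub>quot_space V N\<^esub> (N +>\<^bsub>V\<^esub> w) = N +>\<^bsub>V\<^esub> (v \<oplus>\<^bsub>V\<^esub> w)"
  using abelian_subgroup.a_rcos_sum[OF submodule_abelian_subgroup[OF assms(1)]] assms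
  by (simp add: quot_space_simps)

lemma vectorspace_quot_space:
  assumes "vectorspace K V" "submodule K N V" shows "vectorspace K (quot_space V N)"
proof -
  interpret V: vectorspace K V by fact
  interpret A: abelian_subgroup N V by (rule submodule_abelian_subgroup) fact
  interpret N: submodule K N V by fact
  have zero: "\<zero>\<^bsub>quot_space V N\<^esub> = N +>\<^bsub>V\<^esub> \<zero>\<^bsub>V\<^esub>"
    using V.M.a_coset_add_zero[OF N.subset] by (simp add: quot_space_simps)
  note simps = quot_space_add_coset[OF assms(2)] quot_space_coset_closed zero
  have ag: "abelian_group (quot_space V N)"
  proof (rule abelian_groupI)
    fix x assume "x \<in> carrier (quot_space V N)"
    then obtain v where v: "v \<in> carrier V" "x = N +>\<^bsub>V\<^esub> v" by (rule quot_space_carrierE)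
    then show "\<exists>y\<in>carrier (quot_space V N). y \<oplus>\<^bsub>quot_space V N\<^esub> x = \<zero>\<^bsub>quot_space V N\<^esub>"
      by (intro bexI[of _ "N +>\<^bsub>V\<^esub> (\<ominus>\<^bsub>V\<^esub> v)"]) (simp_all add: simps V.M.l_neg)
  qed (auto elim!: quot_space_carrierE simp: simps V.M.a_ac)
  have "module K (quot_space V N)"
    by (rule moduleI[OF V.R.is_cring ag])
      (auto elim!: quot_space_carrierE simp: quot_space_smult_coset[OF assms(2)]
        quot_space_add_coset[OF assms(2)] quot_space_coset_closed
        V.smult_l_distr V.smult_r_distr V.smult_assoc1)
  thus ?thesis unfolding vectorspace_def using V.field_axioms by simp
qed

lemma free_gen_closed: "field K \<Longrightarrow> s \<in> S \<Longrightarrow> free_gen K s \<in> carrier (free_space K S)"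
  by (auto simp: free_space_simps free_gen_def field_def domain_def cring_def ring.ring_simprules intro: finite_subset[of _ "{s}"])

lemma submodule_tensor_null:
  assumes "field K" "vectorspace K V" "vectorspace K W"
  shows "tensor_rels K V W \<subseteq> carrier (free_space K (carrier V \<times> carrier W))"
    and "submodule K (tensor_null K V W) (free_space K (carrier V \<times> carrier W))"
proof -
  let ?F = "free_space K (carrier V \<times> carrier W)"
  interpret F: vectorspace K ?F by (rule vectorspace_free_space) fact
  interpret V: vectorspace K V by fact
  interpret W: vectorspace K W by fact
  have g: "free_gen K (v, w) \<in> carrier ?F" if "v \<in> carrier V" "w \<in> carrier W" for v w
    by (rule free_gen_closed[OF assms(1)]) (use that in simp)
  show sub: "tensor_rels K V W \<subseteq> carrier ?F"
    unfolding tensor_rels_def Let_def by (auto intro!: F.M.minus_closed F.M.add.m_closed F.smult_closed g)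
  show "submodule K (tensor_null K V W) ?F"
    unfolding tensor_null_def by (rule F.span_is_submodule[OF sub])
qed

lemma vectorspace_tensor:
  assumes "vectorspace K V" "vectorspace K W" shows "vectorspace K (tensor K V W)"
proof -
  have "field K" using assms unfolding vectorspace_def by simp
  then show ?thesis unfolding tensor_def
    using vectorspace_quot_space[OF vectorspace_free_space submodule_tensor_null(2)] assms by blast
qed

lemma lin_ext_hom:
  fixes K :: "('k, 'r) ring_scheme"
  assumes P: "vectorspace K P" and h: "h \<in> S \<rightarrow> carrier P"
  defines "\<Phi> \<equiv> \<lambda>f. \<Oplus>\<^bsub>P\<^esub>p\<in>{p. f p \<noteq> \<zero>\<^bsub>K\<^esub>}. f p \<odot>\<^bsub>P\<^esub> h p"
  shows "\<Phi> \<in> module_hom K (free_space K S) P"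
    and "s \<in> S \<Longrightarrow> \<Phi> (free_gen K s) = h s"
proof -
  interpret P: vectorspace K P by fact
  have ext: "\<Phi> f = (\<Oplus>\<^bsub>P\<^esub>p\<in>D. f p \<odot>\<^bsub>P\<^esub> h p)"
    if "finite D" "{p. f p \<noteq> \<zero>\<^bsub>K\<^esub>} \<subseteq> D" "D \<subseteq> S" "f \<in> UNIV \<rightarrow> carrier K" for f D
    unfolding \<Phi>_def
    by (rule P.M.add.finprod_mono_neutral_cong_left) (use that h in \<open>auto simp: Pi_iff\<close>)
  show "\<Phi> \<in> module_hom K (free_space K S) P"
    unfolding module_hom_def
  proof (safe)
    fix f assume f: "f \<in> carrier (free_space K S)"
    then show "\<Phi> f \<in> carrier P"
      unfolding \<Phi>_def using h by (intro P.M.finsum_closed) (auto simp: free_space_simps Pi_iff)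
  next
    fix f g assume f: "f \<in> carrier (free_space K S)" and g: "g \<in> carrier (free_space K S)"
    define D where "D = {p. f p \<noteq> \<zero>\<^bsub>K\<^esub>} \<union> {p. g p \<noteq> \<zero>\<^bsub>K\<^esub>}"
    have D: "finite D" "D \<subseteq> S" using f g by (auto simp: D_def free_space_simps)
    have "\<Phi> (f \<oplus>\<^bsub>free_space K S\<^esub> g) = (\<Oplus>\<^bsub>P\<^esub>p\<in>D. (f p \<oplus>\<^bsub>K\<^esub> g p) \<odot>\<^bsub>P\<^esub> h p)"
      using f g D by (subst ext[of D]) (auto simp: D_def free_space_simps Pi_iff)
    also have "\<dots> = (\<Oplus>\<^bsub>P\<^esub>p\<in>D. f p \<odot>\<^bsub>P\<^esub> h p \<oplus>\<^bsub>P\<^esub> g p \<odot>\<^bsub>P\<^esub> h p)"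
      using f g D h by (intro P.M.finsum_cong') (auto simp: free_space_simps Pi_iff P.smult_l_distr)
    also have "\<dots> = (\<Oplus>\<^bsub>P\<^esub>p\<in>D. f p \<odot>\<^bsub>P\<^esub> h p) \<oplus>\<^bsub>P\<^esub> (\<Oplus>\<^bsub>P\<^esub>p\<in>D. g p \<odot>\<^bsub>P\<^esub> h p)"
      using f g D h by (intro P.M.finsum_addf) (auto simp: free_space_simps Pi_iff)
    also have "\<dots> = \<Phi> f \<oplus>\<^bsub>P\<^esub> \<Phi> g"
      using f g D by (subst (1 2) ext[of D]) (auto simp: D_def free_space_simps)
    finally show "\<Phi> (f \<oplus>\<^bsub>free_space K S\<^esub> g) = \<Phi> f \<oplus>\<^bsub>P\<^esub> \<Phi> g" .
  next
    fix a f assume a: "a \<in> carrier K" and f: "f \<in> carrier (free_space K S)"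
    define D where "D = {p. f p \<noteq> \<zero>\<^bsub>K\<^esub>}"
    have D: "finite D" "D \<subseteq> S" using f by (auto simp: D_def free_space_simps)
    have "\<Phi> (a \<odot>\<^bsub>free_space K S\<^esub> f) = (\<Oplus>\<^bsub>P\<^esub>p\<in>D. (a \<otimes>\<^bsub>K\<^esub> f p) \<odot>\<^bsub>P\<^esub> h p)"
      using f a D by (subst ext[of D]) (auto simp: D_def free_space_simps Pi_iff)
    also have "\<dots> = (\<Oplus>\<^bsub>P\<^esub>p\<in>D. a \<odot>\<^bsub>P\<^esub> (f p \<odot>\<^bsub>P\<^esub> h p))"
      using f a D h by (intro P.M.finsum_cong') (auto simp: free_space_simps Pi_iff P.smult_assoc1)
    also have "\<dots> = a \<odot>\<^bsub>P\<^esub> (\<Oplus>\<^bsub>P\<^esub>p\<in>D. f p \<odot>\<^bsub>P\<^esub> h p)"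
      by (rule P.finsum_smult_ldistr[symmetric]) (use f a D h in \<open>auto simp: free_space_simps Pi_iff\<close>)
    finally show "\<Phi> (a \<odot>\<^bsub>free_space K S\<^esub> f) = a \<odot>\<^bsub>P\<^esub> \<Phi> f"
      by (simp add: \<Phi>_def D_def)
  qed
  show "\<Phi> (free_gen K s) = h s" if "s \<in> S"
  proof -
    have hs: "h s \<in> carrier P" using h that by auto
    have "\<Phi> (free_gen K s) = (\<Oplus>\<^bsub>P\<^esub>p\<in>{s}. free_gen K s p \<odot>\<^bsub>P\<^esub> h p)"
      using that by (intro ext) (auto simp: free_gen_def)
    then show ?thesis using hs by (simp add: free_gen_def)
  qed
qed

lemma bilinear_map_closed:
  "bilinear_map K V W P b \<Longrightarrow> v \<in> carrier V \<Longrightarrow> w \<in> carrier W \<Longrightarrow> b v w \<in> carrier P"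
  unfolding bilinear_map_def using module_hom_closed by (metis PiE)

lemma tensor_lift_coset:
  assumes V: "vectorspace K V" and W: "vectorspace K W" and P: "vectorspace K P"
    and b: "bilinear_map K V W P b"
    and f: "f \<in> carrier (free_space K (carrier V \<times> carrier W))"
  shows "tensor_lift K V W P b
      (tensor_null K V W +>\<^bsub>free_space K (carrier V \<times> carrier W)\<^esub> f) =
    (\<Oplus>\<^bsub>P\<^esub>p\<in>{p. f p \<noteq> \<zero>\<^bsub>K\<^esub>}. f p \<odot>\<^bsub>P\<^esub> b (fst p) (snd p))"
proof -
  let ?F = "free_space K (carrier V \<times> carrier W)" and ?N = "tensor_null K V W"
  interpret V: vectorspace K V by fact
  interpret W: vectorspace K W by fact
  interpret P: vectorspace K P by fact
  have K: "field K" ..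
  interpret F: vectorspace K ?F by (rule vectorspace_free_space) fact
  define \<Phi> where "\<Phi> = (\<lambda>f. \<Oplus>\<^bsub>P\<^esub>p\<in>{p. f p \<noteq> \<zero>\<^bsub>K\<^esub>}. f p \<odot>\<^bsub>P\<^esub> b (fst p) (snd p))"
  have bc: "b v w \<in> carrier P" if "v \<in> carrier V" "w \<in> carrier W" for v w
    using b that unfolding bilinear_map_def module_hom_def by auto
  have h: "(\<lambda>p. b (fst p) (snd p)) \<in> carrier V \<times> carrier W \<rightarrow> carrier P" using bc by auto
  have hom: "\<Phi> \<in> module_hom K ?F P" and gen: "\<And>v w. v \<in> carrier V \<Longrightarrow> w \<in> carrier W \<Longrightarrow> \<Phi> (free_gen K (v,w)) = b v w"
    using lin_ext_hom[OF P h] unfolding \<Phi>_def by auto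
  interpret \<Phi>: mod_hom K ?F P \<Phi> by unfold_locales (rule hom)
  have g: "free_gen K (v, w) \<in> carrier ?F" if "v \<in> carrier V" "w \<in> carrier W" for v w
    by (rule free_gen_closed[OF K]) (use that in simp)
  have b1: "b (v \<oplus>\<^bsub>V\<^esub> v') w = b v w \<oplus>\<^bsub>P\<^esub> b v' w" if "v \<in> carrier V" "v' \<in> carrier V" "w \<in> carrier W" for v v' w
    using b that unfolding bilinear_map_def module_hom_def by auto
  have b2: "b v (w \<oplus>\<^bsub>W\<^esub> w') = b v w \<oplus>\<^bsub>P\<^esub> b v w'" if "v \<in> carrier V" "w \<in> carrier W" "w' \<in> carrier W" for v w w'
    using b that unfolding bilinear_map_def module_hom_def by auto
  have b3: "b (a \<odot>\<^bsub>V\<^esub> v) w = a \<odot>\<^bsub>P\<^esub> b v w" if "a \<in> carrier K" "v \<in> carrier V" "w \<in> carrier W" for a v w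
    using b that unfolding bilinear_map_def module_hom_def by auto
  have b4: "b v (a \<odot>\<^bsub>W\<^esub> w) = a \<odot>\<^bsub>P\<^esub> b v w" if "a \<in> carrier K" "v \<in> carrier V" "w \<in> carrier W" for a v w
    using b that unfolding bilinear_map_def module_hom_def by auto
  have rels: "tensor_rels K V W \<subseteq> \<Phi>.ker"
    unfolding tensor_rels_def Let_def \<Phi>.ker_def
    by (auto simp: g gen bc b1 b2 b3 b4 P.M.minus_eq P.M.r_neg
       intro!: F.M.minus_closed F.M.add.m_closed F.smult_closed)
  have null: "?N \<subseteq> \<Phi>.ker"
    unfolding tensor_null_def by (rule F.span_is_subset[OF rels \<Phi>.ker_is_submodule])
  interpret A: abelian_subgroup ?N ?F
    by (rule submodule_abelian_subgroup[OF submodule_tensor_null(2)[OF K V W]])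
  let ?X = "?N +>\<^bsub>?F\<^esub> f"
  have "(SOME g. g \<in> ?X) \<in> ?X" using someI[of "\<lambda>g. g \<in> ?X" f] A.a_rcos_self[OF f] by blast
  then obtain n where n: "n \<in> ?N" "(SOME g. g \<in> ?X) = n \<oplus>\<^bsub>?F\<^esub> f" by (auto simp: a_r_coset_def')
  then have "\<Phi> (SOME g. g \<in> ?X) = \<Phi> f"
    using null f unfolding \<Phi>.ker_def by auto
  then show ?thesis unfolding tensor_lift_def \<Phi>_def Let_def by simp
qed

lemma tensor_lift_tens:
  assumes "vectorspace K V" "vectorspace K W" "vectorspace K P"
    and "bilinear_map K V W P b" "v \<in> carrier V" "w \<in> carrier W"
  shows "tensor_lift K V W P b (tens K V W v w) = b v w"
proof -
  have K: "field K" using assms(1) unfolding vectorspace_def by simp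
  have "(\<lambda>p. b (fst p) (snd p)) \<in> carrier V \<times> carrier W \<rightarrow> carrier P"
    using bilinear_map_closed[OF assms(4)] by auto
  from lin_ext_hom(2)[OF assms(3) this, of "(v, w)"] show ?thesis
    using assms unfolding tens_def
    by (subst tensor_lift_coset[OF assms(1-4) free_gen_closed[OF K]]) auto
qed

lemma tensor_lift_hom:
  assumes V: "vectorspace K V" and W: "vectorspace K W" and P: "vectorspace K P"
    and b: "bilinear_map K V W P b"
  shows "tensor_lift K V W P b \<in> module_hom K (tensor K V W) P"
proof -
  let ?F = "free_space K (carrier V \<times> carrier W)" and ?N = "tensor_null K V W"
  have K: "field K" using V unfolding vectorspace_def by simp
  interpret F: vectorspace K ?F by (rule vectorspace_free_space) fact
  note sub = submodule_tensor_null(2)[OF K V W]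
  have "(\<lambda>p. b (fst p) (snd p)) \<in> carrier V \<times> carrier W \<rightarrow> carrier P"
    using bilinear_map_closed[OF b] by auto
  note hom = lin_ext_hom(1)[OF P this]
  show ?thesis
    unfolding module_hom_def tensor_def
    using module_hom_closed[OF hom] module_hom_add[OF hom] module_hom_smult[OF hom]
    by (auto elim!: quot_space_carrierE simp: tensor_lift_coset[OF assms] quot_space_add_coset[OF sub]
      quot_space_smult_coset[OF sub])
qed

lemma tens_bilinear:
  assumes V: "vectorspace K V" and W: "vectorspace K W"
  shows "bilinear_map K V W (tensor K V W) (tens K V W)"
proof -
  let ?F = "free_space K (carrier V \<times> carrier W)" and ?N = "tensor_null K V W"
  interpret V: vectorspace K V by fact
  interpret W: vectorspace K W by fact
  have K: "field K" ..
  interpret F: vectorspace K ?F by (rule vectorspace_free_space) fact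
  note sub = submodule_tensor_null(2)[OF K V W]
  interpret A: abelian_subgroup ?N ?F by (rule submodule_abelian_subgroup[OF sub])
  have g: "free_gen K (v, w) \<in> carrier ?F" if "v \<in> carrier V" "w \<in> carrier W" for v w
    by (rule free_gen_closed[OF K]) (use that in simp)
  have eq: "?N +>\<^bsub>?F\<^esub> x = ?N +>\<^bsub>?F\<^esub> y"
    if "x \<ominus>\<^bsub>?F\<^esub> y \<in> tensor_rels K V W" "x \<in> carrier ?F" "y \<in> carrier ?F" for x y
  proof -
    have "x \<ominus>\<^bsub>?F\<^esub> y \<in> ?N"
      unfolding tensor_null_def using F.in_own_span[OF submodule_tensor_null(1)[OF K V W]] that by auto
    moreover have "x = (x \<ominus>\<^bsub>?F\<^esub> y) \<oplus>\<^bsub>?F\<^esub> y"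
      using that F.M.minus_eq F.M.a_assoc F.M.l_neg F.M.r_zero by simp
    ultimately have "x \<in> ?N +>\<^bsub>?F\<^esub> y" unfolding a_r_coset_def' by auto
    then show ?thesis using A.a_repr_independence' that A.a_subgroup by metis
  qed
  let ?t = "tens K V W"
  have 1: "?t v w \<in> carrier (tensor K V W)" if "v \<in> carrier V" "w \<in> carrier W" for v w
    unfolding tens_def tensor_def using that by (intro quot_space_coset_closed g)
  have 2: "?t (v \<oplus>\<^bsub>V\<^esub> v') w = ?t v w \<oplus>\<^bsub>tensor K V W\<^esub> ?t v' w"
    if "v \<in> carrier V" "v' \<in> carrier V" "w \<in> carrier W" for v v' w
  proof -
    have "free_gen K (v \<oplus>\<^bsub>V\<^esub> v', w) \<ominus>\<^bsub>?F\<^esub> (free_gen K (v, w) \<oplus>\<^bsub>?F\<^esub> free_gen K (v', w)) \<in> tensor_rels K V W"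
      unfolding tensor_rels_def Let_def using that by blast
    from eq[OF this] show ?thesis
      unfolding tens_def tensor_def using that
      by (simp add: quot_space_add_coset[OF sub] quot_space_smult_coset[OF sub] g)
  qed
  have 3: "?t v (w \<oplus>\<^bsub>W\<^esub> w') = ?t v w \<oplus>\<^bsub>tensor K V W\<^esub> ?t v w'"
    if "v \<in> carrier V" "w \<in> carrier W" "w' \<in> carrier W" for v w w'
  proof -
    have "free_gen K (v, w \<oplus>\<^bsub>W\<^esub> w') \<ominus>\<^bsub>?F\<^esub> (free_gen K (v, w) \<oplus>\<^bsub>?F\<^esub> free_gen K (v, w')) \<in> tensor_rels K V W"
      unfolding tensor_rels_def Let_def using that by blast
    from eq[OF this] show ?thesis
      unfolding tens_def tensor_def using that
      by (simp add: quot_space_add_coset[OF sub] quot_space_smult_coset[OF sub] g)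
  qed
  have 4: "?t (a \<odot>\<^bsub>V\<^esub> v) w = a \<odot>\<^bsub>tensor K V W\<^esub> ?t v w"
    if "a \<in> carrier K" "v \<in> carrier V" "w \<in> carrier W" for a v w
  proof -
    have "free_gen K (a \<odot>\<^bsub>V\<^esub> v, w) \<ominus>\<^bsub>?F\<^esub> a \<odot>\<^bsub>?F\<^esub> free_gen K (v, w) \<in> tensor_rels K V W"
      unfolding tensor_rels_def Let_def using that by blast
    from eq[OF this] show ?thesis
      unfolding tens_def tensor_def using that
      by (simp add: quot_space_add_coset[OF sub] quot_space_smult_coset[OF sub] g)
  qed
  have 5: "?t v (a \<odot>\<^bsub>W\<^esub> w) = a \<odot>\<^bsub>tensor K V W\<^esub> ?t v w"
    if "a \<in> carrier K" "v \<in> carrier V" "w \<in> carrier W" for a v w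
  proof -
    have "free_gen K (v, a \<odot>\<^bsub>W\<^esub> w) \<ominus>\<^bsub>?F\<^esub> a \<odot>\<^bsub>?F\<^esub> free_gen K (v, w) \<in> tensor_rels K V W"
      unfolding tensor_rels_def Let_def using that by blast
    from eq[OF this] show ?thesis
      unfolding tens_def tensor_def using that
      by (simp add: quot_space_add_coset[OF sub] quot_space_smult_coset[OF sub] g)
  qed
  show ?thesis
    unfolding bilinear_map_def module_hom_def using 1 2 3 4 5 by simp
qed


section \<open>Coalgebras, comodules, coideals\<close>

locale coalgebra = vectorspace K C
  for K :: "('k, 'r) ring_scheme" and C :: "('k, 'c, 'y) module_scheme" +
  fixes \<Delta> :: "'c \<Rightarrow> ('c \<times> 'c \<Rightarrow> 'k) set" and \<epsilon> :: "'c \<Rightarrow> 'k"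
  assumes comult_hom: "\<Delta> \<in> module_hom K C (tensor K C C)"
    and counit_hom: "\<epsilon> \<in> module_hom K C (self_space K)"
    and coassoc: "c \<in> carrier C \<Longrightarrow>
      tensor_assoc K C C C (tensor_map K C C (tensor K C C) C \<Delta> (\<lambda>x. x) (\<Delta> c)) =
      tensor_map K C C C (tensor K C C) (\<lambda>x. x) \<Delta> (\<Delta> c)"
    and counit_left: "c \<in> carrier C \<Longrightarrow>
      tensor_lift K C C C (\<lambda>c\<^sub>1 c\<^sub>2. \<epsilon> c\<^sub>1 \<odot>\<^bsub>C\<^esub> c\<^sub>2) (\<Delta> c) = c"
    and counit_right: "c \<in> carrier C \<Longrightarrow>
      tensor_lift K C C C (\<lambda>c\<^sub>1 c\<^sub>2. \<epsilon> c\<^sub>2 \<odot>\<^bsub>C\<^esub> c\<^sub>1) (\<Delta> c) = c"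

locale right_comodule = coalgebra K C \<Delta> \<epsilon> + M?: vectorspace K M
  for K :: "('k, 'r) ring_scheme" and C :: "('k, 'c, 'y) module_scheme"
    and \<Delta> :: "'c \<Rightarrow> ('c \<times> 'c \<Rightarrow> 'k) set" and \<epsilon> :: "'c \<Rightarrow> 'k"
    and M :: "('k, 'm, 'z) module_scheme" +
  fixes \<rho> :: "'m \<Rightarrow> ('m \<times> 'c \<Rightarrow> 'k) set"
  assumes coact_hom: "\<rho> \<in> module_hom K M (tensor K M C)"
    and coact_coassoc: "m \<in> carrier M \<Longrightarrow>
      tensor_assoc K M C C (tensor_map K M C (tensor K M C) C \<rho> (\<lambda>x. x) (\<rho> m)) =
      tensor_map K M C M (tensor K C C) (\<lambda>x. x) \<Delta> (\<rho> m)"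
    and coact_counit: "m \<in> carrier M \<Longrightarrow>
      tensor_lift K M C M (\<lambda>m\<^sub>0 m\<^sub>1. \<epsilon> m\<^sub>1 \<odot>\<^bsub>M\<^esub> m\<^sub>0) (\<rho> m) = m"

locale coideal = coalgebra K C \<Delta> \<epsilon> + I?: subspace K I C
  for K :: "('k, 'r) ring_scheme" and C :: "('k, 'c, 'y) module_scheme"
    and \<Delta> :: "'c \<Rightarrow> ('c \<times> 'c \<Rightarrow> 'k) set" and \<epsilon> :: "'c \<Rightarrow> 'k" and I :: "'c set" +
  assumes comult_coideal: "\<Delta> ` I \<subseteq>
      tensor_sub K C C I (carrier C) <+>\<^bsub>tensor K C C\<^esub> tensor_sub K C C (carrier C) I"
    and counit_coideal: "i \<in> I \<Longrightarrow> \<epsilon> i = \<zero>\<^bsub>K\<^esub>"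


section \<open>\<open>\<D>\<close>-maps and the \<open>\<D>\<close>-equation\<close>

definition D_map :: "('k, 'r) ring_scheme \<Rightarrow> ('k, 'c, 'y) module_scheme \<Rightarrow>
    ('c \<Rightarrow> ('c \<times> 'c \<Rightarrow> 'k) set) \<Rightarrow> 'c set \<Rightarrow> (('c \<times> 'c set \<Rightarrow> 'k) set \<Rightarrow> 'k) \<Rightarrow> bool" where
  "D_map K C \<Delta> I \<sigma> \<longleftrightarrow> (let Q = quot_space C I in
     \<sigma> \<in> module_hom K (tensor K C Q) (self_space K) \<and>
     (\<forall>c\<in>carrier C. \<forall>d\<in>carrier Q.
        tensor_lift K C C Q (\<lambda>c\<^sub>1 c\<^sub>2. \<sigma> (tens K C Q c\<^sub>1 d) \<odot>\<^bsub>Q\<^esub> (I +>\<^bsub>C\<^esub> c\<^sub>2)) (\<Delta> c) =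
        tensor_lift K C C Q (\<lambda>c\<^sub>1 c\<^sub>2. \<sigma> (tens K C Q c\<^sub>2 d) \<odot>\<^bsub>Q\<^esub> (I +>\<^bsub>C\<^esub> c\<^sub>1)) (\<Delta> c)))"

text \<open>\<open>V \<otimes> V \<otimes> V\<close> is read as \<open>(V \<otimes> V) \<otimes> V\<close>, so \<open>R\<^sup>2\<^sup>3\<close> is \<open>I \<otimes> R\<close> conjugated by the associativity
  isomorphism.\<close>

definition op12 :: "('k, 'r) ring_scheme \<Rightarrow> ('k, 'v, 'y) module_scheme \<Rightarrow>
    (('v \<times> 'v \<Rightarrow> 'k) set \<Rightarrow> ('v \<times> 'v \<Rightarrow> 'k) set) \<Rightarrow>
    (('v \<times> 'v \<Rightarrow> 'k) set \<times> 'v \<Rightarrow> 'k) set \<Rightarrow> (('v \<times> 'v \<Rightarrow> 'k) set \<times> 'v \<Rightarrow> 'k) set" where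
  "op12 K V R = tensor_map K (tensor K V V) V (tensor K V V) V R (\<lambda>x. x)"

definition op23 :: "('k, 'r) ring_scheme \<Rightarrow> ('k, 'v, 'y) module_scheme \<Rightarrow>
    (('v \<times> 'v \<Rightarrow> 'k) set \<Rightarrow> ('v \<times> 'v \<Rightarrow> 'k) set) \<Rightarrow>
    (('v \<times> 'v \<Rightarrow> 'k) set \<times> 'v \<Rightarrow> 'k) set \<Rightarrow> (('v \<times> 'v \<Rightarrow> 'k) set \<times> 'v \<Rightarrow> 'k) set" where
  "op23 K V R = tensor_assoc_inv K V V V \<circ>
     tensor_map K V (tensor K V V) V (tensor K V V) (\<lambda>x. x) R \<circ> tensor_assoc K V V V"

definition solves_D_equation :: "('k, 'r) ring_scheme \<Rightarrow> ('k, 'v, 'y) module_scheme \<Rightarrow>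
    (('v \<times> 'v \<Rightarrow> 'k) set \<Rightarrow> ('v \<times> 'v \<Rightarrow> 'k) set) \<Rightarrow> bool" where
  "solves_D_equation K V R \<longleftrightarrow>
     R \<in> module_hom K (tensor K V V) (tensor K V V) \<and>
     (\<forall>x\<in>carrier (tensor K (tensor K V V) V).
        (op12 K V R \<circ> op23 K V R) x = (op23 K V R \<circ> op12 K V R) x)"

definition R_map :: "('k, 'r) ring_scheme \<Rightarrow> ('k, 'c, 'y) module_scheme \<Rightarrow> 'c set \<Rightarrow>
    (('c \<times> 'c set \<Rightarrow> 'k) set \<Rightarrow> 'k) \<Rightarrow> ('k, 'm, 'z) module_scheme \<Rightarrow>
    ('m \<Rightarrow> ('m \<times> 'c \<Rightarrow> 'k) set) \<Rightarrow> ('m \<times> 'm \<Rightarrow> 'k) set \<Rightarrow> ('m \<times> 'm \<Rightarrow> 'k) set" where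
  "R_map K C I \<sigma> M \<rho> = (let MM = tensor K M M in
     tensor_lift K M M MM (\<lambda>m n.
       tensor_lift K M C MM (\<lambda>m\<^sub>0 m\<^sub>1.
         tensor_lift K M C MM (\<lambda>n\<^sub>0 n\<^sub>1.
           \<sigma> (tens K C (quot_space C I) m\<^sub>1 (I +>\<^bsub>C\<^esub> n\<^sub>1)) \<odot>\<^bsub>MM\<^esub> tens K M M m\<^sub>0 n\<^sub>0)
         (\<rho> n))
       (\<rho> m)))"

end

theory Submission
  imports Defs
begin

text \<open>The functionals on \<open>C\<close> act on \<open>M\<close> by \<open>\<alpha> \<cdot> m = \<Sum> \<alpha>(m\<^sub>1) m\<^sub>0\<close>, and coassociativity of \<open>\<rho>\<close>
  says that composing two actions is acting by the convolution product. Put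
  \<open>A\<^sub>e = \<sigma>(- \<otimes> e) \<cdot>\<close> and \<open>B\<^sub>c = \<sigma>(c \<otimes> -) \<cdot>\<close>; applying \<open>\<sigma>(c \<otimes> -)\<close> to the \<open>\<D>\<close>-map
  identity shows that the two functionals commute under convolution, so \<open>A\<^sub>e\<close> and \<open>B\<^sub>c\<close> commute.
  Since \<open>R(m \<otimes> n) = \<Sum> m\<^sub>0 \<otimes> B n = \<Sum> A m \<otimes> n\<^sub>0\<close>, with indices \<open>m\<^sub>1\<close> and \<open>n\<^sub>1\<close>, both sides of
  the \<open>\<D>\<close>-equation send \<open>l \<otimes> m \<otimes> n\<close> to \<open>\<Sum> l\<^sub>0 \<otimes> (A B m) \<otimes> n\<^sub>0\<close> up to the order of \<open>A\<close> and \<open>B\<close>.\<close>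

section \<open>Linear maps on tensor products\<close>

lemma module_hom_mem:
  "f \<in> module_hom K V W \<Longrightarrow> v \<in> carrier V \<Longrightarrow> f v \<in> carrier W"
  by (auto simp: module_hom_def)

lemma module_hom_id: "(\<lambda>v. v) \<in> module_hom K V V"
  by (auto simp: module_hom_def)

lemma module_hom_compose:
  "f \<in> module_hom K U V \<Longrightarrow> g \<in> module_hom K V W \<Longrightarrow> (\<lambda>u. g (f u)) \<in> module_hom K U W"
  by (auto simp: module_hom_def Pi_iff)

text \<open>An infinite index set fits in as well: \<open>finsum\<close> is then zero on both sides,
  and a linear map preserves zero.\<close>

lemma module_hom_finsum:
  assumes V: "vectorspace K V" and W: "vectorspace K W" and f: "f \<in> module_hom K V W"
    and g: "g \<in> S \<rightarrow> carrier V"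
  shows "f (\<Oplus>\<^bsub>V\<^esub>s\<in>S. g s) = (\<Oplus>\<^bsub>W\<^esub>s\<in>S. f (g s))"
proof -
  interpret V: vectorspace K V by fact
  interpret W: vectorspace K W by fact
  interpret f: mod_hom K V W f by unfold_locales fact
  show ?thesis
    using g by (induction S rule: infinite_finite_induct) (auto simp: Pi_iff)
qed

text \<open>With the scalars as a target space, functionals are ordinary elements of
  \<open>module_hom\<close>, and every fact about linear maps applies to them.\<close>

lemma vectorspace_self_space:
  assumes "field K" shows "vectorspace K (self_space K)"
proof -
  interpret K: field K by fact
  have "abelian_group (self_space K)"
    by (rule abelian_groupI)
      (auto simp: self_space_def K.a_ac intro: bexI[of _ "\<ominus>\<^bsub>K\<^esub> x" for x] K.l_neg)
  then have "module K (self_space K)"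
    by (intro moduleI) (auto simp: self_space_def K.l_distr K.r_distr K.m_assoc K.is_cring)
  then show ?thesis unfolding vectorspace_def using assms by simp
qed

text \<open>Evaluation at a point \<open>s\<close> is linear, so it passes through the abstract sum.
  Of the evaluated summands only the one at \<open>s\<close> can survive.\<close>

lemma free_space_expansion:
  assumes K: "field K" and f: "f \<in> carrier (free_space K S)"
  shows "(\<Oplus>\<^bsub>free_space K S\<^esub>p\<in>{p. f p \<noteq> \<zero>\<^bsub>K\<^esub>}. f p \<odot>\<^bsub>free_space K S\<^esub> free_gen K p) = f"
proof
  fix s
  let ?F = "free_space K S" and ?D = "{p. f p \<noteq> \<zero>\<^bsub>K\<^esub>}"
  interpret K: field K by fact
  interpret F: vectorspace K ?F by (rule vectorspace_free_space[OF K])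
  interpret E: vectorspace K "self_space K" by (rule vectorspace_self_space[OF K])
  have D: "finite ?D" "?D \<subseteq> S" and fc: "f p \<in> carrier K" for p
    using f by (auto simp: free_space_simps)
  have ev: "(\<lambda>g. g s) \<in> module_hom K ?F (self_space K)"
    by (auto simp: module_hom_def self_space_def free_space_def)
  have "(\<Oplus>\<^bsub>?F\<^esub>p\<in>?D. f p \<odot>\<^bsub>?F\<^esub> free_gen K p) s
      = (\<Oplus>\<^bsub>self_space K\<^esub>p\<in>?D. (f p \<odot>\<^bsub>?F\<^esub> free_gen K p) s)"
    using D fc
    by (intro module_hom_finsum[OF F.vectorspace_axioms E.vectorspace_axioms ev])
      (auto intro!: F.smult_closed free_gen_closed[OF K])
  also have "\<dots> = (\<Oplus>\<^bsub>self_space K\<^esub>p\<in>?D. if s = p then f p else \<zero>\<^bsub>self_space K\<^esub>)"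
    using fc by (intro E.M.finsum_cong') (auto simp: free_space_simps free_gen_def self_space_def)
  also have "\<dots> = f s"
  proof (cases "s \<in> ?D")
    case True
    with D(1) fc show ?thesis
      by (intro E.M.finsum_singleton) (auto simp: self_space_def)
  next
    \<comment> \<open>Here \<open>f s\<close> is zero and \<open>s\<close> lies outside the index
      set, so every summand vanishes.\<close>
    case False
    then have "(\<Oplus>\<^bsub>self_space K\<^esub>p\<in>?D. if s = p then f p else \<zero>\<^bsub>self_space K\<^esub>)
        = (\<Oplus>\<^bsub>self_space K\<^esub>p\<in>?D. \<zero>\<^bsub>self_space K\<^esub>)"
      by (intro E.M.finsum_cong') auto
    with False show ?thesis unfolding E.M.finsum_zero by (simp add: self_space_def)
  qed
  finally show "(\<Oplus>\<^bsub>?F\<^esub>p\<in>?D. f p \<odot>\<^bsub>?F\<^esub> free_gen K p) s = f s" .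
qed

section \<open>Cosets and the representatives behind Sweedler sums\<close>

lemma coset_hom:
  assumes "vectorspace K V" "submodule K N V"
  shows "(\<lambda>v. N +>\<^bsub>V\<^esub> v) \<in> module_hom K V (quot_space V N)"
  using assms by (auto simp: module_hom_def quot_space_add_coset quot_space_smult_coset
    quot_space_coset_closed)

text \<open>A coset is nonempty and contained in the free space, so the representative picked by
  \<open>tensor_lift\<close> has finite support in the product of the carriers.\<close>

lemma tensor_some_closed:
  assumes V: "vectorspace K V" and W: "vectorspace K W" and X: "X \<in> carrier (tensor K V W)"
  shows "(SOME f. f \<in> X) \<in> carrier (free_space K (carrier V \<times> carrier W))"
proof -
  let ?F = "free_space K (carrier V \<times> carrier W)" and ?N = "tensor_null K V W"
  have K: "field K" using V unfolding vectorspace_def by simp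
  note sub = submodule_tensor_null(2)[OF K V W]
  interpret A: abelian_subgroup ?N ?F by (rule submodule_abelian_subgroup[OF sub])
  obtain f where f: "f \<in> carrier ?F" "X = ?N +>\<^bsub>?F\<^esub> f"
    using X unfolding tensor_def by (rule quot_space_carrierE)
  have "f \<in> X" unfolding f(2) using A.a_rcos_self f(1) by blast
  then have "(SOME f. f \<in> X) \<in> X" by (rule someI[of "\<lambda>f. f \<in> X"])
  moreover have "X \<subseteq> carrier ?F"
    unfolding f(2) using f(1) A.a_subset by (intro A.a_r_coset_subset_G)
  ultimately show ?thesis by blast
qed

text \<open>A tensor has one chosen representative, shared by all \<open>b\<close> and \<open>P\<close>; therefore
  \<open>tensor_lift\<close> is a genuine finite sum even before \<open>b\<close> is known to be bilinear.\<close>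

lemma tensor_lift_expand:
  assumes V: "vectorspace K V" and W: "vectorspace K W" and X: "X \<in> carrier (tensor K V W)"
  defines "f \<equiv> SOME f. f \<in> X"
  shows "tensor_lift K V W P b X =
      (\<Oplus>\<^bsub>P\<^esub>p\<in>{p. f p \<noteq> \<zero>\<^bsub>K\<^esub>}. f p \<odot>\<^bsub>P\<^esub> b (fst p) (snd p))"
    and "finite {p. f p \<noteq> \<zero>\<^bsub>K\<^esub>}" "f p \<in> carrier K"
    and "f p \<noteq> \<zero>\<^bsub>K\<^esub> \<Longrightarrow> fst p \<in> carrier V" "f p \<noteq> \<zero>\<^bsub>K\<^esub> \<Longrightarrow> snd p \<in> carrier W"
  using tensor_some_closed[OF V W X] unfolding f_def
  by (auto simp: tensor_lift_def Let_def free_space_simps)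

text \<open>Both sides sum over the same representative of \<open>X\<close>, so agreement on the
  carriers suffices. This is the rule for rewriting under a Sweedler sum.\<close>

lemma tensor_lift_cong:
  assumes "vectorspace K V" "vectorspace K W" "vectorspace K P" "X \<in> carrier (tensor K V W)"
    and b: "\<And>v w. v \<in> carrier V \<Longrightarrow> w \<in> carrier W \<Longrightarrow> b v w = b' v w"
    and c: "\<And>v w. v \<in> carrier V \<Longrightarrow> w \<in> carrier W \<Longrightarrow> b' v w \<in> carrier P"
  shows "tensor_lift K V W P b X = tensor_lift K V W P b' X"
proof -
  interpret P: vectorspace K P by fact
  note e = tensor_lift_expand[OF assms(1,2,4)]
  show ?thesis unfolding e(1)
    by (rule P.M.finsum_cong') (use e(2-5) b c in auto)
qed

lemma tensor_lift_closed:
  assumes "vectorspace K V" "vectorspace K W" "vectorspace K P" "X \<in> carrier (tensor K V W)"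
    and c: "\<And>v w. v \<in> carrier V \<Longrightarrow> w \<in> carrier W \<Longrightarrow> b v w \<in> carrier P"
  shows "tensor_lift K V W P b X \<in> carrier P"
proof -
  interpret P: vectorspace K P by fact
  note e = tensor_lift_expand[OF assms(1,2,4)]
  show ?thesis unfolding e(1)
    by (rule P.M.finsum_closed) (use e(2-5) c in auto)
qed

text \<open>The lift is a finite sum with scalar coefficients, and a linear map passes through
  it.\<close>

lemma module_hom_tensor_lift:
  assumes "vectorspace K V" "vectorspace K W" "vectorspace K P" "vectorspace K Q"
    and X: "X \<in> carrier (tensor K V W)" and h: "h \<in> module_hom K P Q"
    and c: "\<And>v w. v \<in> carrier V \<Longrightarrow> w \<in> carrier W \<Longrightarrow> b v w \<in> carrier P"
  shows "h (tensor_lift K V W P b X) = tensor_lift K V W Q (\<lambda>v w. h (b v w)) X"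
proof -
  interpret P: vectorspace K P by fact
  interpret Q: vectorspace K Q by fact
  note e = tensor_lift_expand[OF assms(1,2) X]
  show ?thesis unfolding e(1)
    using e(2-5) c h
    by (subst module_hom_finsum[OF assms(3,4) h])
      (auto simp: module_hom_mem module_hom_smult intro!: Q.M.finsum_cong')
qed

text \<open>The tensor \<open>X\<close> stays fixed while the summand varies. The representative
  does not depend on \<open>u\<close>, so linearity is checked term by term. It yields the linearity
  of nested lifts in an outer variable.\<close>

lemma tensor_lift_parameter_hom:
  assumes "vectorspace K V" "vectorspace K W" "vectorspace K P" and U: "vectorspace K U"
    and X: "X \<in> carrier (tensor K V W)"
    and h: "\<And>v w. v \<in> carrier V \<Longrightarrow> w \<in> carrier W \<Longrightarrow> (\<lambda>u. b u v w) \<in> module_hom K U P"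
  shows "(\<lambda>u. tensor_lift K V W P (b u) X) \<in> module_hom K U P"
proof -
  interpret P: vectorspace K P by fact
  interpret U: vectorspace K U by fact
  note e = tensor_lift_expand[OF assms(1,2) X]
  define f where "f = (SOME f. f \<in> X)"
  define D where "D = {p. f p \<noteq> \<zero>\<^bsub>K\<^esub>}"
  have c: "b u (fst p) (snd p) \<in> carrier P" if "p \<in> D" "u \<in> carrier U" for u p
    using that e(4,5) module_hom_mem[OF h] unfolding D_def f_def by blast
  have fc: "f p \<in> carrier K" for p unfolding f_def by (rule e(3))
  have *: "b (u \<oplus>\<^bsub>U\<^esub> u') (fst p) (snd p) = b u (fst p) (snd p) \<oplus>\<^bsub>P\<^esub> b u' (fst p) (snd p)"
    if "p \<in> D" "u \<in> carrier U" "u' \<in> carrier U" for u u' p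
    using that e(4,5) module_hom_add[OF h] unfolding D_def f_def by blast
  have **: "b (a \<odot>\<^bsub>U\<^esub> u) (fst p) (snd p) = a \<odot>\<^bsub>P\<^esub> b u (fst p) (snd p)"
    if "p \<in> D" "a \<in> carrier K" "u \<in> carrier U" for a u p
    using that e(4,5) module_hom_smult[OF h] unfolding D_def f_def by blast
  have D: "finite D" unfolding D_def f_def by (rule e(2))
  show ?thesis unfolding e(1) f_def[symmetric] D_def[symmetric]
    unfolding module_hom_def
  proof (safe)
    fix u assume "u \<in> carrier U"
    then show "(\<Oplus>\<^bsub>P\<^esub>p\<in>D. f p \<odot>\<^bsub>P\<^esub> b u (fst p) (snd p)) \<in> carrier P"
      by (intro P.M.finsum_closed) (auto simp: c fc)
  next
    fix u u' assume u: "u \<in> carrier U" "u' \<in> carrier U"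
    have "(\<Oplus>\<^bsub>P\<^esub>p\<in>D. f p \<odot>\<^bsub>P\<^esub> b (u \<oplus>\<^bsub>U\<^esub> u') (fst p) (snd p)) =
        (\<Oplus>\<^bsub>P\<^esub>p\<in>D. f p \<odot>\<^bsub>P\<^esub> b u (fst p) (snd p) \<oplus>\<^bsub>P\<^esub> f p \<odot>\<^bsub>P\<^esub> b u' (fst p) (snd p))"
      using u by (intro P.M.finsum_cong') (auto simp: c fc * P.smult_r_distr)
    also have "\<dots> = (\<Oplus>\<^bsub>P\<^esub>p\<in>D. f p \<odot>\<^bsub>P\<^esub> b u (fst p) (snd p)) \<oplus>\<^bsub>P\<^esub>
        (\<Oplus>\<^bsub>P\<^esub>p\<in>D. f p \<odot>\<^bsub>P\<^esub> b u' (fst p) (snd p))"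
      using u by (intro P.M.finsum_addf) (auto simp: c fc)
    finally show "(\<Oplus>\<^bsub>P\<^esub>p\<in>D. f p \<odot>\<^bsub>P\<^esub> b (u \<oplus>\<^bsub>U\<^esub> u') (fst p) (snd p)) = \<dots>" .
  next
    fix a u assume u: "a \<in> carrier K" "u \<in> carrier U"
    have "(\<Oplus>\<^bsub>P\<^esub>p\<in>D. f p \<odot>\<^bsub>P\<^esub> b (a \<odot>\<^bsub>U\<^esub> u) (fst p) (snd p)) =
        (\<Oplus>\<^bsub>P\<^esub>p\<in>D. a \<odot>\<^bsub>P\<^esub> (f p \<odot>\<^bsub>P\<^esub> b u (fst p) (snd p)))"
      using u by (intro P.M.finsum_cong')
        (auto simp: c fc ** P.smult_assoc1[symmetric] P.R.m_comm)
    also have "\<dots> = a \<odot>\<^bsub>P\<^esub> (\<Oplus>\<^bsub>P\<^esub>p\<in>D. f p \<odot>\<^bsub>P\<^esub> b u (fst p) (snd p))"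
      using u D by (intro P.finsum_smult_ldistr[symmetric]) (auto simp: c fc)
    finally show "(\<Oplus>\<^bsub>P\<^esub>p\<in>D. f p \<odot>\<^bsub>P\<^esub> b (a \<odot>\<^bsub>U\<^esub> u) (fst p) (snd p)) = \<dots>" .
  qed
qed

lemma (in abelian_monoid) finsum_swap:
  assumes "finite A" "finite B" "\<And>a b. a \<in> A \<Longrightarrow> b \<in> B \<Longrightarrow> g a b \<in> carrier G"
  shows "(\<Oplus>a\<in>A. \<Oplus>b\<in>B. g a b) = (\<Oplus>b\<in>B. \<Oplus>a\<in>A. g a b)"
  using assms(1,3)
proof (induction A)
  case (insert a A)
  have "(\<Oplus>b\<in>B. \<Oplus>a\<in>insert a A. g a b) = (\<Oplus>b\<in>B. g a b \<oplus> (\<Oplus>a\<in>A. g a b))"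
    using insert by (intro finsum_cong') (auto intro!: finsum_closed)
  also have "\<dots> = (\<Oplus>b\<in>B. g a b) \<oplus> (\<Oplus>b\<in>B. \<Oplus>a\<in>A. g a b)"
    using insert by (intro finsum_addf) (auto intro!: finsum_closed)
  finally show ?case
    using insert by (subst finsum_insert) (auto intro!: finsum_closed)
qed simp

text \<open>Two independent Sweedler sums form a finite double sum over the two chosen
  representatives, whose order can be exchanged.\<close>

lemma tensor_lift_swap:
  assumes V: "vectorspace K V" and W: "vectorspace K W" and V': "vectorspace K V'"
    and W': "vectorspace K W'" and P: "vectorspace K P"
    and X: "X \<in> carrier (tensor K V W)" and Y: "Y \<in> carrier (tensor K V' W')"
    and b: "\<And>v w v' w'. v \<in> carrier V \<Longrightarrow> w \<in> carrier W \<Longrightarrow> v' \<in> carrier V' \<Longrightarrow>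
      w' \<in> carrier W' \<Longrightarrow> b v w v' w' \<in> carrier P"
  shows "tensor_lift K V W P (\<lambda>v w. tensor_lift K V' W' P (\<lambda>v' w'. b v w v' w') Y) X =
    tensor_lift K V' W' P (\<lambda>v' w'. tensor_lift K V W P (\<lambda>v w. b v w v' w') X) Y"
proof -
  interpret P: vectorspace K P by fact
  note e = tensor_lift_expand[OF V W X] and e' = tensor_lift_expand[OF V' W' Y]
  define f where "f = (SOME f. f \<in> X)"
  define D where "D = {p. f p \<noteq> \<zero>\<^bsub>K\<^esub>}"
  define f' where "f' = (SOME f. f \<in> Y)"
  define D' where "D' = {p. f' p \<noteq> \<zero>\<^bsub>K\<^esub>}"
  have c: "b (fst p) (snd p) (fst q) (snd q) \<in> carrier P" if "p \<in> D" "q \<in> D'" for p q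
    using that b e(4,5) e'(4,5) unfolding D_def f_def D'_def f'_def by blast
  have fc: "f p \<in> carrier K" for p unfolding f_def by (rule e(3))
  have fc': "f' p \<in> carrier K" for p unfolding f'_def by (rule e'(3))
  have D: "finite D" unfolding D_def f_def by (rule e(2))
  have D': "finite D'" unfolding D'_def f'_def by (rule e'(2))
  let ?b = "\<lambda>p q. b (fst p) (snd p) (fst q) (snd q)"
  have "(\<Oplus>\<^bsub>P\<^esub>p\<in>D. f p \<odot>\<^bsub>P\<^esub> (\<Oplus>\<^bsub>P\<^esub>q\<in>D'. f' q \<odot>\<^bsub>P\<^esub> ?b p q)) =
      (\<Oplus>\<^bsub>P\<^esub>p\<in>D. \<Oplus>\<^bsub>P\<^esub>q\<in>D'. f p \<odot>\<^bsub>P\<^esub> (f' q \<odot>\<^bsub>P\<^esub> ?b p q))"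
    using D' by (intro P.M.finsum_cong' P.finsum_smult_ldistr)
      (auto simp: c fc fc' intro!: P.M.finsum_closed)
  also have "\<dots> = (\<Oplus>\<^bsub>P\<^esub>q\<in>D'. \<Oplus>\<^bsub>P\<^esub>p\<in>D. f p \<odot>\<^bsub>P\<^esub> (f' q \<odot>\<^bsub>P\<^esub> ?b p q))"
    by (rule P.M.finsum_swap[OF D D']) (auto simp: c fc fc')
  \<comment> \<open>Commutativity of the field lets the coefficients of the two representatives
    trade places.\<close>
  also have "\<dots> = (\<Oplus>\<^bsub>P\<^esub>q\<in>D'. \<Oplus>\<^bsub>P\<^esub>p\<in>D. f' q \<odot>\<^bsub>P\<^esub> (f p \<odot>\<^bsub>P\<^esub> ?b p q))"
    by (intro P.M.finsum_cong')
      (auto simp: c fc fc' P.smult_assoc1[symmetric] P.R.m_comm intro!: P.M.finsum_closed)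
  also have "\<dots> = (\<Oplus>\<^bsub>P\<^esub>q\<in>D'. f' q \<odot>\<^bsub>P\<^esub> (\<Oplus>\<^bsub>P\<^esub>p\<in>D. f p \<odot>\<^bsub>P\<^esub> ?b p q))"
    using D by (intro P.M.finsum_cong' P.finsum_smult_ldistr[symmetric])
      (auto simp: c fc fc' intro!: P.M.finsum_closed)
  finally show ?thesis
    unfolding e(1) e'(1) f_def[symmetric] f'_def[symmetric] D_def[symmetric] D'_def[symmetric] .
qed

text \<open>Expand a representative in the free generators and apply the coset projection, which
  sends generators to pure tensors. Hence every tensor is a linear combination of pure ones.\<close>

lemma tensor_lift_tens_id:
  assumes V: "vectorspace K V" and W: "vectorspace K W" and X: "X \<in> carrier (tensor K V W)"
  shows "tensor_lift K V W (tensor K V W) (tens K V W) X = X"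
proof -
  let ?F = "free_space K (carrier V \<times> carrier W)" and ?N = "tensor_null K V W"
  have K: "field K" using V unfolding vectorspace_def by simp
  interpret K: field K by fact
  note sub = submodule_tensor_null(2)[OF K V W]
  interpret F: vectorspace K ?F by (rule vectorspace_free_space[OF K])
  interpret T: vectorspace K "tensor K V W" by (rule vectorspace_tensor[OF V W])
  have hom: "(\<lambda>f. ?N +>\<^bsub>?F\<^esub> f) \<in> module_hom K ?F (tensor K V W)"
    unfolding tensor_def by (rule coset_hom[OF F.vectorspace_axioms sub])
  obtain f where f: "f \<in> carrier ?F" "X = ?N +>\<^bsub>?F\<^esub> f"
    using X unfolding tensor_def by (rule quot_space_carrierE)
  let ?D = "{p. f p \<noteq> \<zero>\<^bsub>K\<^esub>}"
  have g: "free_gen K p \<in> carrier ?F" if "p \<in> ?D" for p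
    using f(1) that by (intro free_gen_closed[OF K]) (auto simp: free_space_simps)
  have fc: "f p \<in> carrier K" for p using f(1) by (auto simp: free_space_simps)
  have "tensor_lift K V W (tensor K V W) (tens K V W) X =
      (\<Oplus>\<^bsub>tensor K V W\<^esub>p\<in>?D. f p \<odot>\<^bsub>tensor K V W\<^esub> tens K V W (fst p) (snd p))"
    unfolding f(2)
    by (rule tensor_lift_coset[OF V W T.vectorspace_axioms tens_bilinear[OF V W] f(1)])
  also have "\<dots> = (\<Oplus>\<^bsub>tensor K V W\<^esub>p\<in>?D. ?N +>\<^bsub>?F\<^esub> (f p \<odot>\<^bsub>?F\<^esub> free_gen K p))"
    using module_hom_smult[OF hom fc g] module_hom_mem[OF hom] g fc
    by (intro T.M.finsum_cong') (auto simp: tens_def)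
  also have "\<dots> = ?N +>\<^bsub>?F\<^esub> (\<Oplus>\<^bsub>?F\<^esub>p\<in>?D. f p \<odot>\<^bsub>?F\<^esub> free_gen K p)"
    using g fc
    by (intro module_hom_finsum[OF F.vectorspace_axioms T.vectorspace_axioms hom, symmetric]) auto
  also have "\<dots> = X" unfolding f(2) free_space_expansion[OF K f(1)] ..
  finally show ?thesis .
qed

section \<open>Linear maps are determined by their values on pure tensors\<close>

lemma tens_closed:
  "vectorspace K V \<Longrightarrow> vectorspace K W \<Longrightarrow> v \<in> carrier V \<Longrightarrow> w \<in> carrier W \<Longrightarrow>
    tens K V W v w \<in> carrier (tensor K V W)"
  by (rule bilinear_map_closed[OF tens_bilinear])

text \<open>Write \<open>X\<close> as the lift of \<open>tens\<close> at \<open>X\<close>. A linear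
  \<open>h\<close> moves inside the lift, so \<open>h X\<close> is a sum involving only the values
  of \<open>h\<close> on pure tensors.\<close>

lemma tensor_hom_eqI:
  assumes V: "vectorspace K V" and W: "vectorspace K W" and P: "vectorspace K P"
    and f: "f \<in> module_hom K (tensor K V W) P" and g: "g \<in> module_hom K (tensor K V W) P"
    and eq: "\<And>v w. v \<in> carrier V \<Longrightarrow> w \<in> carrier W \<Longrightarrow> f (tens K V W v w) = g (tens K V W v w)"
    and X: "X \<in> carrier (tensor K V W)"
  shows "f X = g X"
proof -
  note T = vectorspace_tensor[OF V W]
  have "h X = tensor_lift K V W P (\<lambda>v w. h (tens K V W v w)) X"
    if "h \<in> module_hom K (tensor K V W) P" for h
    using module_hom_tensor_lift[OF V W T P X that, of "tens K V W"]
    by (simp add: tensor_lift_tens_id[OF V W X] tens_closed[OF V W])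
  then show ?thesis
    using f g tensor_lift_cong[OF V W P X, of "\<lambda>v w. f (tens K V W v w)" "\<lambda>v w. g (tens K V W v w)"]
    by (simp add: eq module_hom_mem[OF g] tens_closed[OF V W])
qed

section \<open>Construction of linear and bilinear maps\<close>

lemma module_hom_cong:
  assumes "vectorspace K V" "g \<in> module_hom K V W"
    and "\<And>v. v \<in> carrier V \<Longrightarrow> f v = g v"
  shows "f \<in> module_hom K V W"
proof -
  interpret V: vectorspace K V by fact
  show ?thesis using assms(2,3) by (auto simp: module_hom_def Pi_iff)
qed

lemma bilinear_mapI:
  "(\<And>v. v \<in> carrier V \<Longrightarrow> b v \<in> module_hom K W P) \<Longrightarrow>
   (\<And>w. w \<in> carrier W \<Longrightarrow> (\<lambda>v. b v w) \<in> module_hom K V P) \<Longrightarrow> bilinear_map K V W P b"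
  by (simp add: bilinear_map_def)

lemma bilinear_map_left:
  "bilinear_map K V W P b \<Longrightarrow> w \<in> carrier W \<Longrightarrow> (\<lambda>v. b v w) \<in> module_hom K V P"
  by (simp add: bilinear_map_def)

lemma bilinear_map_right:
  "bilinear_map K V W P b \<Longrightarrow> v \<in> carrier V \<Longrightarrow> b v \<in> module_hom K W P"
  by (simp add: bilinear_map_def)

lemma bilinear_map_flip:
  "bilinear_map K V W P b \<Longrightarrow> bilinear_map K W V P (\<lambda>w v. b v w)"
  by (simp add: bilinear_map_def)

lemma bilinear_map_compose:
  assumes b: "bilinear_map K V W P b"
    and f: "f \<in> module_hom K V' V" and g: "g \<in> module_hom K W' W" and h: "h \<in> module_hom K P P'"
  shows "bilinear_map K V' W' P' (\<lambda>v w. h (b (f v) (g w)))"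
proof (rule bilinear_mapI)
  fix v assume "v \<in> carrier V'"
  then show "(\<lambda>w. h (b (f v) (g w))) \<in> module_hom K W' P'"
    by (rule module_hom_compose[OF module_hom_compose[OF g bilinear_map_right[OF b module_hom_mem[OF f]]] h])
next
  fix w assume "w \<in> carrier W'"
  then show "(\<lambda>v. h (b (f v) (g w))) \<in> module_hom K V' P'"
    by (rule module_hom_compose[OF module_hom_compose[OF f bilinear_map_left[OF b module_hom_mem[OF g]]] h])
qed

lemma bilinear_map_scale:
  assumes W: "vectorspace K W" and P: "vectorspace K P"
    and \<alpha>: "\<alpha> \<in> module_hom K V (self_space K)" and f: "f \<in> module_hom K W P"
  shows "bilinear_map K V W P (\<lambda>v w. \<alpha> v \<odot>\<^bsub>P\<^esub> f w)"
proof -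
  interpret P: vectorspace K P by fact
  show ?thesis
    using \<alpha> f unfolding bilinear_map_def
    by (auto simp: module_hom_def Pi_iff self_space_def P.smult_l_distr P.smult_r_distr
      P.smult_assoc1[symmetric] P.R.m_comm)
qed

lemma bilinear_map_self_space:
  assumes "field K" shows "bilinear_map K (self_space K) (self_space K) (self_space K) (mult K)"
proof -
  interpret K: field K by fact
  show ?thesis
    unfolding bilinear_map_def
    by (auto simp: module_hom_def self_space_def K.l_distr K.r_distr K.m_ac)
qed

lemma tens_hom_left:
  "vectorspace K V \<Longrightarrow> vectorspace K W \<Longrightarrow> w \<in> carrier W \<Longrightarrow>
    (\<lambda>v. tens K V W v w) \<in> module_hom K V (tensor K V W)"
  by (rule bilinear_map_left[OF tens_bilinear])

lemma tens_hom_right: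
  "vectorspace K V \<Longrightarrow> vectorspace K W \<Longrightarrow> v \<in> carrier V \<Longrightarrow>
    tens K V W v \<in> module_hom K W (tensor K V W)"
  by (rule bilinear_map_right[OF tens_bilinear])

lemma tens_compose_bilinear:
  assumes "vectorspace K V'" "vectorspace K W'"
    and "f \<in> module_hom K V V'" "g \<in> module_hom K W W'"
  shows "bilinear_map K V W (tensor K V' W') (\<lambda>v w. tens K V' W' (f v) (g w))"
  by (rule bilinear_map_compose[OF tens_bilinear[OF assms(1,2)] assms(3,4) module_hom_id])

section \<open>Tensor products of linear maps and the associativity isomorphism\<close>

lemma tensor_map_hom:
  assumes "vectorspace K V" "vectorspace K W" "vectorspace K V'" "vectorspace K W'"
    and "f \<in> module_hom K V V'" "g \<in> module_hom K W W'"
  shows "tensor_map K V W V' W' f g \<in> module_hom K (tensor K V W) (tensor K V' W')"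
  unfolding tensor_map_def
  by (intro tensor_lift_hom tens_compose_bilinear vectorspace_tensor assms)

lemma tensor_map_tens:
  assumes "vectorspace K V" "vectorspace K W" "vectorspace K V'" "vectorspace K W'"
    and "f \<in> module_hom K V V'" "g \<in> module_hom K W W'" "v \<in> carrier V" "w \<in> carrier W"
  shows "tensor_map K V W V' W' f g (tens K V W v w) = tens K V' W' (f v) (g w)"
  unfolding tensor_map_def
  by (intro tensor_lift_tens tens_compose_bilinear vectorspace_tensor assms)

text \<open>Turns a composite with \<open>tensor_map\<close> into a Sweedler sum; this is how both
  sides of the coassociativity of \<rho> are read later.\<close>

lemma module_hom_tensor_map:
  assumes V: "vectorspace K V" and W: "vectorspace K W" and V': "vectorspace K V'"
    and W': "vectorspace K W'" and P: "vectorspace K P"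
    and f: "f \<in> module_hom K V V'" and g: "g \<in> module_hom K W W'"
    and h: "h \<in> module_hom K (tensor K V' W') P" and X: "X \<in> carrier (tensor K V W)"
  shows "h (tensor_map K V W V' W' f g X) =
    tensor_lift K V W P (\<lambda>v w. h (tens K V' W' (f v) (g w))) X"
  unfolding tensor_map_def
  by (rule module_hom_tensor_lift[OF V W vectorspace_tensor[OF V' W'] P X h])
    (simp add: tens_closed V' W' module_hom_mem[OF f] module_hom_mem[OF g])

text \<open>Pure tensors are reduced twice: first in the outer product, then in the left factor with
  \<open>w\<close> held fixed.\<close>

lemma tensor3_hom_eqI:
  assumes U: "vectorspace K U" and V: "vectorspace K V" and W: "vectorspace K W"
    and P: "vectorspace K P"
    and f: "f \<in> module_hom K (tensor K (tensor K U V) W) P"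
    and g: "g \<in> module_hom K (tensor K (tensor K U V) W) P"
    and eq: "\<And>u v w. u \<in> carrier U \<Longrightarrow> v \<in> carrier V \<Longrightarrow> w \<in> carrier W \<Longrightarrow>
      f (tens K (tensor K U V) W (tens K U V u v) w) = g (tens K (tensor K U V) W (tens K U V u v) w)"
    and X: "X \<in> carrier (tensor K (tensor K U V) W)"
  shows "f X = g X"
proof (rule tensor_hom_eqI[OF vectorspace_tensor[OF U V] W P f g _ X])
  fix t w assume t: "t \<in> carrier (tensor K U V)" and w: "w \<in> carrier W"
  note h = tens_hom_left[OF vectorspace_tensor[OF U V] W w]
  show "f (tens K (tensor K U V) W t w) = g (tens K (tensor K U V) W t w)"
    by (rule tensor_hom_eqI[OF U V P module_hom_compose[OF h f] module_hom_compose[OF h g] eq t])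
      (use w in auto)
qed

lemma
  assumes U: "vectorspace K U" and V: "vectorspace K V" and W: "vectorspace K W"
  shows tensor_assoc_hom: "tensor_assoc K U V W \<in>
      module_hom K (tensor K (tensor K U V) W) (tensor K U (tensor K V W))"
    and tensor_assoc_tens: "u \<in> carrier U \<Longrightarrow> v \<in> carrier V \<Longrightarrow> w \<in> carrier W \<Longrightarrow>
      tensor_assoc K U V W (tens K (tensor K U V) W (tens K U V u v) w) =
      tens K U (tensor K V W) u (tens K V W v w)"
proof -
  let ?P = "tensor K U (tensor K V W)"
  let ?b = "\<lambda>w u v. tens K U (tensor K V W) u (tens K V W v w)"
  note T = vectorspace_tensor[OF U V] and T' = vectorspace_tensor[OF V W]
  note P = vectorspace_tensor[OF U T']
  have b: "bilinear_map K U V ?P (?b w)" if "w \<in> carrier W" for w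
    by (rule tens_compose_bilinear[OF U T' module_hom_id tens_hom_left[OF V W that]])
  have w: "(\<lambda>w. ?b w u v) \<in> module_hom K W ?P" if "u \<in> carrier U" "v \<in> carrier V" for u v
    by (rule module_hom_compose[OF tens_hom_right[OF V W that(2)] tens_hom_right[OF U T' that(1)]])
  \<comment> \<open>The inner lift is linear in its tensor for each fixed \<open>w\<close>, and
    linear in \<open>w\<close> as a parameter. Together these make the outer lift well
    behaved.\<close>
  have bil: "bilinear_map K (tensor K U V) W ?P (\<lambda>t w. tensor_lift K U V ?P (?b w) t)"
    by (rule bilinear_mapI[OF tensor_lift_parameter_hom[OF U V P W _ w] tensor_lift_hom[OF U V P b]])
  show "tensor_assoc K U V W \<in> module_hom K (tensor K (tensor K U V) W) ?P"
    unfolding tensor_assoc_def Let_def by (rule tensor_lift_hom[OF T W P bil])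
  show "tensor_assoc K U V W (tens K (tensor K U V) W (tens K U V u v) w) =
      tens K U (tensor K V W) u (tens K V W v w)"
    if "u \<in> carrier U" "v \<in> carrier V" "w \<in> carrier W"
    unfolding tensor_assoc_def Let_def using that
    by (simp add: tensor_lift_tens[OF T W P bil] tens_closed[OF U V] tensor_lift_tens[OF U V P b])
qed

lemma
  assumes U: "vectorspace K U" and V: "vectorspace K V" and W: "vectorspace K W"
  shows tensor_assoc_inv_hom: "tensor_assoc_inv K U V W \<in>
      module_hom K (tensor K U (tensor K V W)) (tensor K (tensor K U V) W)"
    and tensor_assoc_inv_tens: "u \<in> carrier U \<Longrightarrow> v \<in> carrier V \<Longrightarrow> w \<in> carrier W \<Longrightarrow>
      tensor_assoc_inv K U V W (tens K U (tensor K V W) u (tens K V W v w)) =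
      tens K (tensor K U V) W (tens K U V u v) w"
proof -
  let ?P = "tensor K (tensor K U V) W"
  let ?b = "\<lambda>u v w. tens K (tensor K U V) W (tens K U V u v) w"
  note T = vectorspace_tensor[OF U V] and T' = vectorspace_tensor[OF V W]
  note P = vectorspace_tensor[OF T W]
  have b: "bilinear_map K V W ?P (?b u)" if "u \<in> carrier U" for u
    by (rule tens_compose_bilinear[OF T W tens_hom_right[OF U V that] module_hom_id])
  have u: "(\<lambda>u. ?b u v w) \<in> module_hom K U ?P" if "v \<in> carrier V" "w \<in> carrier W" for v w
    by (rule module_hom_compose[OF tens_hom_left[OF U V that(1)] tens_hom_left[OF T W that(2)]])
  \<comment> \<open>Mirror image of the other direction: now the first factor \<open>u\<close> is
    the parameter of the inner lift.\<close>
  have bil: "bilinear_map K U (tensor K V W) ?P (\<lambda>u t. tensor_lift K V W ?P (?b u) t)"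
    by (rule bilinear_mapI[OF tensor_lift_hom[OF V W P b] tensor_lift_parameter_hom[OF V W P U _ u]])
  show "tensor_assoc_inv K U V W \<in> module_hom K (tensor K U (tensor K V W)) ?P"
    unfolding tensor_assoc_inv_def Let_def by (rule tensor_lift_hom[OF U T' P bil])
  show "tensor_assoc_inv K U V W (tens K U (tensor K V W) u (tens K V W v w)) =
      tens K (tensor K U V) W (tens K U V u v) w"
    if "u \<in> carrier U" "v \<in> carrier V" "w \<in> carrier W"
    unfolding tensor_assoc_inv_def Let_def using that
    by (simp add: tensor_lift_tens[OF U T' P bil] tens_closed[OF V W] tensor_lift_tens[OF V W P b])
qed

section \<open>The action of the dual algebra on a comodule\<close>

text \<open>The product of the dual algebra of \<open>C\<close>, for functionals \<alpha> and
  \<beta>.\<close>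

definition convolution :: "('k, 'r) ring_scheme \<Rightarrow> ('k, 'c, 'y) module_scheme \<Rightarrow>
    ('c \<Rightarrow> ('c \<times> 'c \<Rightarrow> 'k) set) \<Rightarrow> ('c \<Rightarrow> 'k) \<Rightarrow> ('c \<Rightarrow> 'k) \<Rightarrow> 'c \<Rightarrow> 'k" where
  "convolution K C \<Delta> \<alpha> \<beta> c =
     tensor_lift K C C (self_space K) (\<lambda>c\<^sub>1 c\<^sub>2. \<alpha> c\<^sub>1 \<otimes>\<^bsub>K\<^esub> \<beta> c\<^sub>2) (\<Delta> c)"

definition dual_action :: "('k, 'r) ring_scheme \<Rightarrow> ('k, 'c, 'y) module_scheme \<Rightarrow>
    ('k, 'm, 'z) module_scheme \<Rightarrow> ('m \<Rightarrow> ('m \<times> 'c \<Rightarrow> 'k) set) \<Rightarrow> ('c \<Rightarrow> 'k) \<Rightarrow> 'm \<Rightarrow> 'm" where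
  "dual_action K C M \<rho> \<alpha> m = tensor_lift K M C M (\<lambda>m\<^sub>0 m\<^sub>1. \<alpha> m\<^sub>1 \<odot>\<^bsub>M\<^esub> m\<^sub>0) (\<rho> m)"

lemma dual_action_hom:
  assumes "vectorspace K C" "vectorspace K M" "\<rho> \<in> module_hom K M (tensor K M C)"
    and "\<alpha> \<in> module_hom K C (self_space K)"
  shows "dual_action K C M \<rho> \<alpha> \<in> module_hom K M M"
  unfolding dual_action_def
  by (intro module_hom_compose[OF assms(3)] tensor_lift_hom bilinear_map_flip[OF bilinear_map_scale]
    module_hom_id assms)

text \<open>The inner action applies \<beta> to the leg of the first coaction, and the outer one
  applies \<alpha> to the leg of the second. Coassociativity replaces these two legs by the
  comultiplication of one leg, with \<alpha> on its first and \<beta> on its second part.\<close>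

lemma dual_action_dual_action:
  assumes "right_comodule K C \<Delta> \<epsilon> M \<rho>"
    and \<alpha>: "\<alpha> \<in> module_hom K C (self_space K)" and \<beta>: "\<beta> \<in> module_hom K C (self_space K)"
    and m: "m \<in> carrier M"
  shows "dual_action K C M \<rho> \<alpha> (dual_action K C M \<rho> \<beta> m) =
    dual_action K C M \<rho> (convolution K C \<Delta> \<alpha> \<beta>) m"
proof -
  interpret right_comodule K C \<Delta> \<epsilon> M \<rho> by fact
  have C: "vectorspace K C" and M: "vectorspace K M" by unfold_locales
  have K: "field K" using C unfolding vectorspace_def by simp
  \<comment> \<open>Commutativity is used when the two bracketings are compared: one produces the
    scalar \<open>\<beta> z\<close> times \<open>\<alpha> y\<close>, the other the reverse
    product.\<close>
  have K': "cring K" using K by (simp add: field_def domain_def)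
  note assoc = M.module.smult_assoc1[symmetric]
  note S = vectorspace_self_space[OF K]
  note MC = vectorspace_tensor[OF M C] and CC = vectorspace_tensor[OF C C]
  note P = vectorspace_tensor[OF MC C]
  \<comment> \<open>The functional \<alpha> \<otimes> \<beta> on \<open>tensor K C C\<close>; the
    convolution is \<phi> after \<Delta>.\<close>
  define \<phi> where "\<phi> = tensor_lift K C C (self_space K) (\<lambda>c\<^sub>1 c\<^sub>2. \<alpha> c\<^sub>1 \<otimes>\<^bsub>K\<^esub> \<beta> c\<^sub>2)"
  have b\<phi>: "bilinear_map K C C (self_space K) (\<lambda>c\<^sub>1 c\<^sub>2. \<alpha> c\<^sub>1 \<otimes>\<^bsub>K\<^esub> \<beta> c\<^sub>2)"
    by (rule bilinear_map_compose[OF bilinear_map_self_space[OF K] \<alpha> \<beta> module_hom_id])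
  have \<phi>: "\<phi> \<in> module_hom K (tensor K C C) (self_space K)"
    unfolding \<phi>_def by (rule tensor_lift_hom[OF C C S b\<phi>])
  \<comment> \<open>\<Theta> evaluates \<alpha> on the middle and \<beta> on the last factor for the
    right bracketing, and \<Gamma> below does so for the left one. They carry the two sides of
    coassociativity into \<open>M\<close>.\<close>
  define \<Theta> where "\<Theta> = tensor_lift K M (tensor K C C) M (\<lambda>x t. \<phi> t \<odot>\<^bsub>M\<^esub> x)"
  have b\<Theta>: "bilinear_map K M (tensor K C C) M (\<lambda>x t. \<phi> t \<odot>\<^bsub>M\<^esub> x)"
    by (rule bilinear_map_flip[OF bilinear_map_scale[OF M M \<phi> module_hom_id]])
  have \<Theta>: "\<Theta> \<in> module_hom K (tensor K M (tensor K C C)) M"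
    unfolding \<Theta>_def by (rule tensor_lift_hom[OF M CC M b\<Theta>])
  define \<Psi> where "\<Psi> = tensor_lift K M C M (\<lambda>x y. \<alpha> y \<odot>\<^bsub>M\<^esub> x)"
  have b\<Psi>: "bilinear_map K M C M (\<lambda>x y. \<alpha> y \<odot>\<^bsub>M\<^esub> x)"
    by (rule bilinear_map_flip[OF bilinear_map_scale[OF M M \<alpha> module_hom_id]])
  have \<Psi>: "\<Psi> \<in> module_hom K (tensor K M C) M"
    unfolding \<Psi>_def by (rule tensor_lift_hom[OF M C M b\<Psi>])
  define \<Gamma> where "\<Gamma> = tensor_lift K (tensor K M C) C M (\<lambda>t z. \<beta> z \<odot>\<^bsub>M\<^esub> \<Psi> t)"
  have b\<Gamma>: "bilinear_map K (tensor K M C) C M (\<lambda>t z. \<beta> z \<odot>\<^bsub>M\<^esub> \<Psi> t)"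
    by (rule bilinear_map_flip[OF bilinear_map_scale[OF MC M \<beta> \<Psi>]])
  have \<Gamma>: "\<Gamma> \<in> module_hom K (tensor K (tensor K M C) C) M"
    unfolding \<Gamma>_def by (rule tensor_lift_hom[OF MC C M b\<Gamma>])
  have \<rho>m: "\<rho> m \<in> carrier (tensor K M C)" using coact_hom m by (rule module_hom_mem)
  have eq: "\<Theta> (tensor_assoc K M C C X) = \<Gamma> X"
    if X: "X \<in> carrier (tensor K (tensor K M C) C)" for X
  proof (rule tensor3_hom_eqI[OF M C C M module_hom_compose[OF tensor_assoc_hom[OF M C C] \<Theta>] \<Gamma> _ X])
    fix x y z assume xyz: "x \<in> carrier M" "y \<in> carrier C" "z \<in> carrier C"
    have "\<alpha> y \<in> carrier K" "\<beta> z \<in> carrier K"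
      using module_hom_mem[OF \<alpha>] module_hom_mem[OF \<beta>] xyz by (auto simp: self_space_def)
    moreover have "\<phi> (tens K C C y z) = \<alpha> y \<otimes>\<^bsub>K\<^esub> \<beta> z"
      unfolding \<phi>_def by (rule tensor_lift_tens[OF C C S b\<phi> xyz(2,3)])
    moreover have "\<Psi> (tens K M C x y) = \<alpha> y \<odot>\<^bsub>M\<^esub> x"
      unfolding \<Psi>_def by (rule tensor_lift_tens[OF M C M b\<Psi> xyz(1,2)])
    ultimately show "\<Theta> (tensor_assoc K M C C (tens K (tensor K M C) C (tens K M C x y) z)) =
        \<Gamma> (tens K (tensor K M C) C (tens K M C x y) z)"
      using xyz unfolding \<Theta>_def \<Gamma>_def
      by (simp add: tensor_assoc_tens[OF M C C] tensor_lift_tens[OF M CC M b\<Theta>] tens_closed[OF C C]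
        tensor_lift_tens[OF MC C M b\<Gamma>] tens_closed[OF M C] assoc cring.cring_simprules(14)[OF K'])
  qed
  have \<beta>c: "\<beta> y \<in> carrier K" if "y \<in> carrier C" for y
    using module_hom_mem[OF \<beta> that] by (simp add: self_space_def)
  have act: "dual_action K C M \<rho> \<alpha> x = \<Psi> (\<rho> x)" for x
    by (simp add: dual_action_def \<Psi>_def)
  note acth = dual_action_hom[OF C M coact_hom \<alpha>]
  have "dual_action K C M \<rho> \<alpha> (dual_action K C M \<rho> \<beta> m) =
      tensor_lift K M C M (\<lambda>x y. dual_action K C M \<rho> \<alpha> (\<beta> y \<odot>\<^bsub>M\<^esub> x)) (\<rho> m)"
    unfolding dual_action_def[of _ _ _ _ \<beta>]
    by (rule module_hom_tensor_lift[OF M C M M \<rho>m acth]) (simp add: \<beta>c)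
  also have "\<dots> = tensor_lift K M C M (\<lambda>x y. \<Gamma> (tens K (tensor K M C) C (\<rho> x) y)) (\<rho> m)"
    by (rule tensor_lift_cong[OF M C M \<rho>m])
      (simp_all add: \<beta>c module_hom_smult[OF coact_hom] module_hom_smult[OF \<Psi>] act \<Gamma>_def tensor_lift_tens[OF MC C M b\<Gamma>]
        module_hom_mem[OF coact_hom] module_hom_mem[OF \<Psi>])
  also have "\<dots> = \<Gamma> (tensor_map K M C (tensor K M C) C \<rho> (\<lambda>x. x) (\<rho> m))"
    by (rule module_hom_tensor_map[OF M C MC C M coact_hom module_hom_id \<Gamma> \<rho>m, symmetric])
  \<comment> \<open>\<open>eq\<close> inserts the associator, and \<open>coact_coassoc\<close> then
    trades a second coaction for a comultiplication.\<close>
  also have "\<dots> = \<Theta> (tensor_map K M C M (tensor K C C) (\<lambda>x. x) \<Delta> (\<rho> m))"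
    using eq[OF module_hom_mem[OF tensor_map_hom[OF M C MC C coact_hom module_hom_id] \<rho>m]]
    by (simp add: coact_coassoc[OF m])
  also have "\<dots> = tensor_lift K M C M (\<lambda>x y. \<Theta> (tens K M (tensor K C C) x (\<Delta> y))) (\<rho> m)"
    by (rule module_hom_tensor_map[OF M C M CC M module_hom_id comult_hom \<Theta> \<rho>m])
  also have "\<dots> = dual_action K C M \<rho> (convolution K C \<Delta> \<alpha> \<beta>) m"
    unfolding dual_action_def convolution_def \<phi>_def[symmetric]
    by (rule tensor_lift_cong[OF M C M \<rho>m])
      (use module_hom_mem[OF \<phi>] in \<open>simp_all add: \<Theta>_def tensor_lift_tens[OF M CC M b\<Theta>]
        module_hom_mem[OF comult_hom] self_space_def\<close>)
  finally show ?thesis .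
qed

text \<open>Apply the functional \<sigma>(c \<otimes> -) on the quotient to the defining identity of
  a \<D>-map at \<open>e\<close> and \<open>d\<close>. It turns the coset of one half of the
  comultiplication of \<open>e\<close> into a value of \<beta>, while the other half sits in
  \<alpha>; the two sides are the two convolutions.\<close>

lemma D_map_convolution_commute:
  assumes "coideal K C \<Delta> \<epsilon> I" and D: "D_map K C \<Delta> I \<sigma>"
    and c: "c \<in> carrier C" and d: "d \<in> carrier (quot_space C I)" and e: "e \<in> carrier C"
  defines "\<alpha> \<equiv> \<lambda>x. \<sigma> (tens K C (quot_space C I) x d)"
    and "\<beta> \<equiv> \<lambda>x. \<sigma> (tens K C (quot_space C I) c (I +>\<^bsub>C\<^esub> x))"
  shows "convolution K C \<Delta> \<alpha> \<beta> e = convolution K C \<Delta> \<beta> \<alpha> e"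
proof -
  interpret coideal K C \<Delta> \<epsilon> I by fact
  let ?Q = "quot_space C I"
  have C: "vectorspace K C" by unfold_locales
  have K: "field K" using C unfolding vectorspace_def by simp
  have K': "cring K" using K by (simp add: field_def domain_def)
  note S = vectorspace_self_space[OF K]
  have sub: "submodule K I C" by (rule I.submod)
  note Q = vectorspace_quot_space[OF C sub]
  have \<sigma>: "\<sigma> \<in> module_hom K (tensor K C ?Q) (self_space K)"
    and eq: "tensor_lift K C C ?Q (\<lambda>c\<^sub>1 c\<^sub>2. \<alpha> c\<^sub>1 \<odot>\<^bsub>?Q\<^esub> (I +>\<^bsub>C\<^esub> c\<^sub>2)) (\<Delta> e) =
      tensor_lift K C C ?Q (\<lambda>c\<^sub>1 c\<^sub>2. \<alpha> c\<^sub>2 \<odot>\<^bsub>?Q\<^esub> (I +>\<^bsub>C\<^esub> c\<^sub>1)) (\<Delta> e)"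
    using D d e unfolding D_map_def Let_def \<alpha>_def by auto
  \<comment> \<open>The functional on the quotient through which \<beta> factors: \<beta> is
    \<open>?s\<close> after the projection.\<close>
  let ?s = "\<lambda>x. \<sigma> (tens K C ?Q c x)"
  note s = module_hom_compose[OF tens_hom_right[OF C Q c] \<sigma>]
  have \<Delta>e: "\<Delta> e \<in> carrier (tensor K C C)" by (rule module_hom_mem[OF comult_hom e])
  have \<alpha>: "\<alpha> x \<in> carrier K" if "x \<in> carrier C" for x
    using module_hom_mem[OF \<sigma> tens_closed[OF C Q that d]] by (simp add: \<alpha>_def self_space_def)
  have \<beta>: "\<beta> x \<in> carrier K" if "x \<in> carrier C" for x
    using module_hom_mem[OF s quot_space_coset_closed[OF that]] by (simp add: \<beta>_def self_space_def)
  interpret Q: vectorspace K ?Q by (rule Q)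
  have *: "?s (\<alpha> x \<odot>\<^bsub>?Q\<^esub> (I +>\<^bsub>C\<^esub> y)) = \<alpha> x \<otimes>\<^bsub>K\<^esub> \<beta> y" if "x \<in> carrier C" "y \<in> carrier C" for x y
    using module_hom_smult[OF s \<alpha>[OF that(1)] quot_space_coset_closed[OF that(2)]]
    by (simp add: \<beta>_def self_space_def)
  have closed: "\<alpha> x \<odot>\<^bsub>?Q\<^esub> (I +>\<^bsub>C\<^esub> y) \<in> carrier ?Q" if "x \<in> carrier C" "y \<in> carrier C" for x y
    by (rule Q.smult_closed[OF \<alpha>[OF that(1)] quot_space_coset_closed[OF that(2)]])
  have "convolution K C \<Delta> \<alpha> \<beta> e =
      tensor_lift K C C (self_space K) (\<lambda>x y. ?s (\<alpha> x \<odot>\<^bsub>?Q\<^esub> (I +>\<^bsub>C\<^esub> y))) (\<Delta> e)"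
    unfolding convolution_def
    by (rule tensor_lift_cong[OF C C S \<Delta>e]) (use module_hom_mem[OF s closed] in \<open>simp_all add: *\<close>)
  also have "\<dots> = ?s (tensor_lift K C C ?Q (\<lambda>x y. \<alpha> x \<odot>\<^bsub>?Q\<^esub> (I +>\<^bsub>C\<^esub> y)) (\<Delta> e))"
    by (rule module_hom_tensor_lift[OF C C Q S \<Delta>e s, symmetric]) (rule closed)
  also have "\<dots> = ?s (tensor_lift K C C ?Q (\<lambda>x y. \<alpha> y \<odot>\<^bsub>?Q\<^esub> (I +>\<^bsub>C\<^esub> x)) (\<Delta> e))"
    unfolding eq ..
  also have "\<dots> = tensor_lift K C C (self_space K) (\<lambda>x y. ?s (\<alpha> y \<odot>\<^bsub>?Q\<^esub> (I +>\<^bsub>C\<^esub> x))) (\<Delta> e)"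
    by (rule module_hom_tensor_lift[OF C C Q S \<Delta>e s]) (rule closed)
  \<comment> \<open>The scalars appear in the order \<alpha>, \<beta> and are commuted to match the
    convolution with \<beta> first.\<close>
  also have "\<dots> = convolution K C \<Delta> \<beta> \<alpha> e"
    unfolding convolution_def
    by (rule tensor_lift_cong[OF C C S \<Delta>e]) (simp_all add: * \<alpha> \<beta> cring.cring_simprules(14)[OF K'],
        simp add: \<alpha> \<beta> self_space_def)
  finally show ?thesis .
qed

section \<open>Commuting operators on the comodule and the \<D>-equation\<close>

theorem proposition5p3:
  fixes K :: "('k, 'r) ring_scheme"
    and C :: "('k, 'c, 'y) module_scheme"
    and \<Delta> :: "'c \<Rightarrow> ('c \<times> 'c \<Rightarrow> 'k) set"
    and \<epsilon> :: "'c \<Rightarrow> 'k"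
    and I :: "'c set"
    and \<sigma> :: "('c \<times> 'c set \<Rightarrow> 'k) set \<Rightarrow> 'k"
    and M :: "('k, 'm, 'z) module_scheme"
    and \<rho> :: "'m \<Rightarrow> ('m \<times> 'c \<Rightarrow> 'k) set"
  assumes "field K"
    and "coalgebra K C \<Delta> \<epsilon>"
    and "coideal K C \<Delta> \<epsilon> I"
    and "D_map K C \<Delta> I \<sigma>"
    and "right_comodule K C \<Delta> \<epsilon> M \<rho>"
  shows "solves_D_equation K M (R_map K C I \<sigma> M \<rho>)"
proof -
  interpret coideal K C \<Delta> \<epsilon> I by fact
  interpret right_comodule K C \<Delta> \<epsilon> M \<rho> by fact
  let ?Q = "quot_space C I" and ?R = "R_map K C I \<sigma> M \<rho>"
  let ?MM = "tensor K M M"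
  let ?MMM = "tensor K ?MM M"
  have C: "vectorspace K C" and M: "vectorspace K M" by unfold_locales
  note S = vectorspace_self_space[OF assms(1)]
  have sub: "submodule K I C" by (rule I.submod)
  note Q = vectorspace_quot_space[OF C sub]
  note MM = vectorspace_tensor[OF M M]
  note MMM = vectorspace_tensor[OF MM M]
  have \<pi>: "(\<lambda>x. I +>\<^bsub>C\<^esub> x) \<in> module_hom K C ?Q" by (rule coset_hom[OF C sub])
  have \<rho>: "\<rho> m \<in> carrier (tensor K M C)" if "m \<in> carrier M" for m
    by (rule module_hom_mem[OF coact_hom that])
  have \<sigma>: "\<sigma> \<in> module_hom K (tensor K C ?Q) (self_space K)"
    using assms(4) unfolding D_map_def Let_def by auto
  define s where "s = (\<lambda>c d. \<sigma> (tens K C ?Q c d))"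
  have bs: "bilinear_map K C ?Q (self_space K) s"
    unfolding s_def by (rule bilinear_map_compose[OF tens_bilinear[OF C Q] module_hom_id module_hom_id \<sigma>])
  \<comment> \<open>Pulling the second argument back along the projection makes both arguments
    elements of \<open>C\<close>, so either one can be fixed to leave a functional on
    \<open>C\<close>.\<close>
  define s' where "s' = (\<lambda>c e. s c (I +>\<^bsub>C\<^esub> e))"
  have bs': "bilinear_map K C C (self_space K) s'"
    unfolding s'_def by (rule bilinear_map_compose[OF bs module_hom_id \<pi> module_hom_id])
  have s'c: "s' c e \<in> carrier K" if "c \<in> carrier C" "e \<in> carrier C" for c e
    using bilinear_map_closed[OF bs' that] by (simp add: self_space_def)
  define A where "A = (\<lambda>e. dual_action K C M \<rho> (\<lambda>c. s' c e))"
  define B where "B = (\<lambda>c. dual_action K C M \<rho> (s' c))"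
  have A_hom: "A e \<in> module_hom K M M" if "e \<in> carrier C" for e
    unfolding A_def by (rule dual_action_hom[OF C M coact_hom bilinear_map_left[OF bs' that]])
  have B_hom: "B c \<in> module_hom K M M" if "c \<in> carrier C" for c
    unfolding B_def by (rule dual_action_hom[OF C M coact_hom bilinear_map_right[OF bs' that]])
  have scale: "(\<lambda>u. f u \<odot>\<^bsub>M\<^esub> m) \<in> module_hom K C M"
    if "f \<in> module_hom K C (self_space K)" "m \<in> carrier M" for f m
    by (rule bilinear_map_left[OF bilinear_map_scale[OF M M that(1) module_hom_id] that(2)])
  \<comment> \<open>Linearity in the index, as opposed to the vector, is what makes the one-sided
    formulas for \<open>r\<close> below lifts of bilinear maps.\<close>
  have A_hom': "(\<lambda>e. A e m) \<in> module_hom K C M" if m: "m \<in> carrier M" for m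
    unfolding A_def dual_action_def
    by (rule tensor_lift_parameter_hom[OF M C M C \<rho>[OF m] scale[OF bilinear_map_right[OF bs']]])
  have B_hom': "(\<lambda>c. B c m) \<in> module_hom K C M" if m: "m \<in> carrier M" for m
    unfolding B_def dual_action_def
    by (rule tensor_lift_parameter_hom[OF M C M C \<rho>[OF m] scale[OF bilinear_map_left[OF bs']]])
  have AB: "A e (B c m) = B c (A e m)"
    if e: "e \<in> carrier C" and c: "c \<in> carrier C" and m: "m \<in> carrier M" for c e m
  proof -
    note act = dual_action_dual_action[OF assms(5) _ _ m]
    have "A e (B c m) = dual_action K C M \<rho> (convolution K C \<Delta> (\<lambda>c. s' c e) (s' c)) m"
      unfolding A_def B_def
      by (rule act[OF bilinear_map_left[OF bs' e] bilinear_map_right[OF bs' c]])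
    \<comment> \<open>The two convolutions are known to agree on \<open>carrier C\<close>, so they
      are exchanged inside the Sweedler sum and not as functions.\<close>
    also have "\<dots> = dual_action K C M \<rho> (convolution K C \<Delta> (s' c) (\<lambda>c. s' c e)) m"
      unfolding dual_action_def
    proof (rule tensor_lift_cong[OF M C M \<rho>[OF m]])
      fix x y assume x: "x \<in> carrier M" and y: "y \<in> carrier C"
      show "convolution K C \<Delta> (\<lambda>c. s' c e) (s' c) y \<odot>\<^bsub>M\<^esub> x =
          convolution K C \<Delta> (s' c) (\<lambda>c. s' c e) y \<odot>\<^bsub>M\<^esub> x"
        using D_map_convolution_commute[OF assms(3,4) c quot_space_coset_closed[OF e] y]
        unfolding s'_def s_def by simp
      have "convolution K C \<Delta> (s' c) (\<lambda>c. s' c e) y \<in> carrier (self_space K)"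
        unfolding convolution_def
        by (rule tensor_lift_closed[OF C C S module_hom_mem[OF comult_hom y]])
          (use s'c[OF c] s'c[OF _ e] in \<open>simp add: self_space_def\<close>)
      then show "convolution K C \<Delta> (s' c) (\<lambda>c. s' c e) y \<odot>\<^bsub>M\<^esub> x \<in> carrier M"
        using x by (simp add: self_space_def)
    qed
    also have "\<dots> = B c (A e m)"
      unfolding A_def B_def
      by (rule act[OF bilinear_map_right[OF bs' c] bilinear_map_left[OF bs' e], symmetric])
    finally show ?thesis .
  qed

  \<comment> \<open>The intended value of \<open>?R\<close> on a pure tensor; bilinearity of
    \<open>r\<close> must be shown before \<open>?R\<close> can be evaluated there.\<close>
  define r where "r = (\<lambda>m n. tensor_lift K M C ?MM (\<lambda>m\<^sub>0 m\<^sub>1. tensor_lift K M C ?MM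
    (\<lambda>n\<^sub>0 n\<^sub>1. s' m\<^sub>1 n\<^sub>1 \<odot>\<^bsub>?MM\<^esub> tens K M M m\<^sub>0 n\<^sub>0) (\<rho> n)) (\<rho> m))"
  have R_def: "?R = tensor_lift K M M ?MM r"
    by (simp add: R_map_def r_def s'_def s_def Let_def)
  interpret MM: vectorspace K ?MM by (rule MM)
  \<comment> \<open>The inner sum over \<open>\<rho> n\<close> collapses: tensoring with a fixed
    left factor is linear, so the scalars move onto the right factor and assemble into
    \<open>B\<close>.\<close>
  have rB: "r m n = tensor_lift K M C ?MM (\<lambda>m\<^sub>0 m\<^sub>1. tens K M M m\<^sub>0 (B m\<^sub>1 n)) (\<rho> m)"
    if m: "m \<in> carrier M" and n: "n \<in> carrier M" for m n
    unfolding r_def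
  proof (rule tensor_lift_cong[OF M C MM \<rho>[OF m]])
    fix x y assume x: "x \<in> carrier M" and y: "y \<in> carrier C"
    note h = tens_hom_right[OF M M x]
    show "tens K M M x (B y n) \<in> carrier ?MM"
      by (rule tens_closed[OF M M x module_hom_mem[OF B_hom[OF y] n]])
    have "tens K M M x (B y n) =
        tensor_lift K M C ?MM (\<lambda>n\<^sub>0 n\<^sub>1. tens K M M x (s' y n\<^sub>1 \<odot>\<^bsub>M\<^esub> n\<^sub>0)) (\<rho> n)"
      unfolding B_def dual_action_def
      by (rule module_hom_tensor_lift[OF M C M MM \<rho>[OF n] h]) (simp add: s'c y)
    also have "\<dots> = tensor_lift K M C ?MM (\<lambda>n\<^sub>0 n\<^sub>1. s' y n\<^sub>1 \<odot>\<^bsub>?MM\<^esub> tens K M M x n\<^sub>0) (\<rho> n)"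
      by (rule tensor_lift_cong[OF M C MM \<rho>[OF n]])
        (use x y in \<open>simp_all add: module_hom_smult[OF h] s'c tens_closed[OF M M]\<close>)
    finally show "tensor_lift K M C ?MM (\<lambda>n\<^sub>0 n\<^sub>1. s' y n\<^sub>1 \<odot>\<^bsub>?MM\<^esub> tens K M M x n\<^sub>0) (\<rho> n) =
        tens K M M x (B y n)" ..
  qed
  \<comment> \<open>Exchanging the two sums first makes \<open>\<rho> m\<close> the inner one, which
    collapses to \<open>A\<close> in the left factor.\<close>
  have rA: "r m n = tensor_lift K M C ?MM (\<lambda>n\<^sub>0 n\<^sub>1. tens K M M (A n\<^sub>1 m) n\<^sub>0) (\<rho> n)"
    if m: "m \<in> carrier M" and n: "n \<in> carrier M" for m n
  proof -
    have "r m n = tensor_lift K M C ?MM (\<lambda>n\<^sub>0 n\<^sub>1. tensor_lift K M C ?MM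
        (\<lambda>m\<^sub>0 m\<^sub>1. s' m\<^sub>1 n\<^sub>1 \<odot>\<^bsub>?MM\<^esub> tens K M M m\<^sub>0 n\<^sub>0) (\<rho> m)) (\<rho> n)"
      unfolding r_def
      by (rule tensor_lift_swap[OF M C M C MM \<rho>[OF m] \<rho>[OF n]]) (simp add: s'c tens_closed[OF M M])
    also have "\<dots> = tensor_lift K M C ?MM (\<lambda>n\<^sub>0 n\<^sub>1. tens K M M (A n\<^sub>1 m) n\<^sub>0) (\<rho> n)"
    proof (rule tensor_lift_cong[OF M C MM \<rho>[OF n]])
      fix x y assume x: "x \<in> carrier M" and y: "y \<in> carrier C"
      note h = tens_hom_left[OF M M x]
      show "tens K M M (A y m) x \<in> carrier ?MM"
        by (rule tens_closed[OF M M module_hom_mem[OF A_hom[OF y] m] x])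
      have "tens K M M (A y m) x =
          tensor_lift K M C ?MM (\<lambda>m\<^sub>0 m\<^sub>1. tens K M M (s' m\<^sub>1 y \<odot>\<^bsub>M\<^esub> m\<^sub>0) x) (\<rho> m)"
        unfolding A_def dual_action_def
        by (rule module_hom_tensor_lift[OF M C M MM \<rho>[OF m] h]) (simp add: s'c y)
      also have "\<dots> = tensor_lift K M C ?MM (\<lambda>m\<^sub>0 m\<^sub>1. s' m\<^sub>1 y \<odot>\<^bsub>?MM\<^esub> tens K M M m\<^sub>0 x) (\<rho> m)"
        by (rule tensor_lift_cong[OF M C MM \<rho>[OF m]])
          (use x y in \<open>simp_all add: module_hom_smult[OF h] s'c tens_closed[OF M M]\<close>)
      finally show "tensor_lift K M C ?MM (\<lambda>m\<^sub>0 m\<^sub>1. s' m\<^sub>1 y \<odot>\<^bsub>?MM\<^esub> tens K M M m\<^sub>0 x) (\<rho> m) =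
          tens K M M (A y m) x" ..
    qed
    finally show ?thesis .
  qed
  \<comment> \<open>In \<open>rA\<close> the vector \<open>n\<close> enters only through
    \<open>\<rho> n\<close>, and in \<open>rB\<close> the vector \<open>m\<close> only through
    \<open>\<rho> m\<close>. Each form therefore gives linearity in one variable, as a lift composed
    with \<rho>.\<close>
  have r: "bilinear_map K M M ?MM r"
  proof (rule bilinear_mapI)
    fix m assume m: "m \<in> carrier M"
    have "bilinear_map K M C ?MM (\<lambda>n\<^sub>0 n\<^sub>1. tens K M M (A n\<^sub>1 m) n\<^sub>0)"
      by (rule bilinear_map_flip[OF tens_compose_bilinear[OF M M A_hom'[OF m] module_hom_id]])
    from module_hom_compose[OF coact_hom tensor_lift_hom[OF M C MM this]]
    show "r m \<in> module_hom K M ?MM"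
      by (rule module_hom_cong[OF M]) (rule rA[OF m])
  next
    fix n assume n: "n \<in> carrier M"
    have "bilinear_map K M C ?MM (\<lambda>m\<^sub>0 m\<^sub>1. tens K M M m\<^sub>0 (B m\<^sub>1 n))"
      by (rule tens_compose_bilinear[OF M M module_hom_id B_hom'[OF n]])
    from module_hom_compose[OF coact_hom tensor_lift_hom[OF M C MM this]]
    show "(\<lambda>m. r m n) \<in> module_hom K M ?MM"
      by (rule module_hom_cong[OF M]) (rule rB[OF _ n])
  qed
  have R: "?R \<in> module_hom K ?MM ?MM"
    unfolding R_def by (rule tensor_lift_hom[OF M M MM r])
  have R_tens: "?R (tens K M M m n) = r m n" if "m \<in> carrier M" "n \<in> carrier M" for m n
    unfolding R_def by (rule tensor_lift_tens[OF M M MM r that])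

  let ?t = "\<lambda>l m n. tens K ?MM M (tens K M M l m) n"
  have t: "?t l m n \<in> carrier ?MMM" if "l \<in> carrier M" "m \<in> carrier M" "n \<in> carrier M" for l m n
    using that by (intro tens_closed MM M)
  have op12: "op12 K M ?R \<in> module_hom K ?MMM ?MMM"
    unfolding op12_def by (rule tensor_map_hom[OF MM M MM M R module_hom_id])
  have op23: "op23 K M ?R \<in> module_hom K ?MMM ?MMM"
    unfolding op23_def comp_def
    by (rule module_hom_compose[OF module_hom_compose[OF tensor_assoc_hom[OF M M M]
      tensor_map_hom[OF M MM M MM module_hom_id R]] tensor_assoc_inv_hom[OF M M M]])
  \<comment> \<open>The form \<open>rB\<close> is chosen here and \<open>rA\<close> for
    \<open>op23\<close>, so that both operators act on the middle factor and otherwise only coact on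
    an outer one.\<close>
  have op12_tens: "op12 K M ?R (?t l m n) =
      tensor_lift K M C ?MMM (\<lambda>l\<^sub>0 l\<^sub>1. ?t l\<^sub>0 (B l\<^sub>1 m) n) (\<rho> l)"
    if l: "l \<in> carrier M" and m: "m \<in> carrier M" and n: "n \<in> carrier M" for l m n
  proof -
    have "op12 K M ?R (?t l m n) = tens K ?MM M (r l m) n"
      unfolding op12_def
      by (simp add: tensor_map_tens[OF MM M MM M R module_hom_id tens_closed[OF M M l m] n] R_tens[OF l m])
    also have "\<dots> = tensor_lift K M C ?MMM (\<lambda>l\<^sub>0 l\<^sub>1. ?t l\<^sub>0 (B l\<^sub>1 m) n) (\<rho> l)"
      unfolding rB[OF l m]
      by (rule module_hom_tensor_lift[OF M C MM MMM \<rho>[OF l] tens_hom_left[OF MM M n]])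
        (simp add: tens_closed[OF M M] module_hom_mem[OF B_hom m])
    finally show ?thesis .
  qed
  have op23_tens: "op23 K M ?R (?t l m n) =
      tensor_lift K M C ?MMM (\<lambda>n\<^sub>0 n\<^sub>1. ?t l (A n\<^sub>1 m) n\<^sub>0) (\<rho> n)"
    if l: "l \<in> carrier M" and m: "m \<in> carrier M" and n: "n \<in> carrier M" for l m n
  proof -
    \<comment> \<open>Tensoring with \<open>l\<close> on the left and then reassociating is one
      linear map, which can be moved through the sum in \<open>rA\<close>.\<close>
    note h = module_hom_compose[OF tens_hom_right[OF M MM l] tensor_assoc_inv_hom[OF M M M]]
    have "op23 K M ?R (?t l m n) = tensor_assoc_inv K M M M (tens K M ?MM l (r m n))"
      unfolding op23_def comp_def
      by (simp add: tensor_assoc_tens[OF M M M l m n] R_tens[OF m n]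
          tensor_map_tens[OF M MM M MM module_hom_id R l tens_closed[OF M M m n]])
    also have "\<dots> = tensor_lift K M C ?MMM
        (\<lambda>n\<^sub>0 n\<^sub>1. tensor_assoc_inv K M M M (tens K M ?MM l (tens K M M (A n\<^sub>1 m) n\<^sub>0))) (\<rho> n)"
      unfolding rA[OF m n]
      by (rule module_hom_tensor_lift[OF M C MM MMM \<rho>[OF n] h])
        (simp add: tens_closed[OF M M] module_hom_mem[OF A_hom m])
    also have "\<dots> = tensor_lift K M C ?MMM (\<lambda>n\<^sub>0 n\<^sub>1. ?t l (A n\<^sub>1 m) n\<^sub>0) (\<rho> n)"
      by (rule tensor_lift_cong[OF M C MMM \<rho>[OF n]])
        (simp_all add: tensor_assoc_inv_tens[OF M M M l] module_hom_mem[OF A_hom m] t l)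
    finally show ?thesis .
  qed

  have "op12 K M ?R (op23 K M ?R X) = op23 K M ?R (op12 K M ?R X)" if X: "X \<in> carrier ?MMM" for X
  proof (rule tensor3_hom_eqI[OF M M M MMM module_hom_compose[OF op23 op12] module_hom_compose[OF op12 op23] _ X])
    fix l m n assume l: "l \<in> carrier M" and m: "m \<in> carrier M" and n: "n \<in> carrier M"
    note Ac = module_hom_mem[OF A_hom] and Bc = module_hom_mem[OF B_hom]
    \<comment> \<open>The common summand of both composites, with \<open>B\<close> applied to the
      middle vector before \<open>A\<close>.\<close>
    let ?g = "\<lambda>l\<^sub>0 l\<^sub>1 n\<^sub>0 n\<^sub>1. ?t l\<^sub>0 (A n\<^sub>1 (B l\<^sub>1 m)) n\<^sub>0"
    have "op12 K M ?R (op23 K M ?R (?t l m n)) =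
        tensor_lift K M C ?MMM (\<lambda>n\<^sub>0 n\<^sub>1. op12 K M ?R (?t l (A n\<^sub>1 m) n\<^sub>0)) (\<rho> n)"
      unfolding op23_tens[OF l m n]
      by (rule module_hom_tensor_lift[OF M C MMM MMM \<rho>[OF n] op12]) (simp add: t l m Ac)
    also have "\<dots> = tensor_lift K M C ?MMM (\<lambda>n\<^sub>0 n\<^sub>1.
        tensor_lift K M C ?MMM (\<lambda>l\<^sub>0 l\<^sub>1. ?g l\<^sub>0 l\<^sub>1 n\<^sub>0 n\<^sub>1) (\<rho> l)) (\<rho> n)"
    proof (rule tensor_lift_cong[OF M C MMM \<rho>[OF n]])
      fix x y assume x: "x \<in> carrier M" and y: "y \<in> carrier C"
      \<comment> \<open>\<open>op12\<close> leaves \<open>B\<close> applied after \<open>A\<close>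
        in the middle factor; the commutation \<open>AB\<close> reverses this to the order in
        \<open>?g\<close>.\<close>
      show "op12 K M ?R (?t l (A y m) x) =
          tensor_lift K M C ?MMM (\<lambda>l\<^sub>0 l\<^sub>1. ?g l\<^sub>0 l\<^sub>1 x y) (\<rho> l)"
        unfolding op12_tens[OF l Ac[OF y m] x]
        by (rule tensor_lift_cong[OF M C MMM \<rho>[OF l]]) (simp_all add: AB t Ac Bc m x y)
      show "tensor_lift K M C ?MMM (\<lambda>l\<^sub>0 l\<^sub>1. ?g l\<^sub>0 l\<^sub>1 x y) (\<rho> l) \<in> carrier ?MMM"
        by (rule tensor_lift_closed[OF M C MMM \<rho>[OF l]]) (simp add: t Ac Bc m x y)
    qed
    \<comment> \<open>The coactions on \<open>l\<close> and on \<open>n\<close> are independent, so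
      their sums can be exchanged. The inner sum over \<open>\<rho> n\<close> is then the value of
      \<open>op23\<close> on a pure tensor.\<close>
    also have "\<dots> = tensor_lift K M C ?MMM (\<lambda>l\<^sub>0 l\<^sub>1.
        tensor_lift K M C ?MMM (\<lambda>n\<^sub>0 n\<^sub>1. ?g l\<^sub>0 l\<^sub>1 n\<^sub>0 n\<^sub>1) (\<rho> n)) (\<rho> l)"
      by (rule tensor_lift_swap[OF M C M C MMM \<rho>[OF n] \<rho>[OF l]]) (simp add: t Ac Bc m)
    also have "\<dots> = tensor_lift K M C ?MMM (\<lambda>l\<^sub>0 l\<^sub>1. op23 K M ?R (?t l\<^sub>0 (B l\<^sub>1 m) n)) (\<rho> l)"
      by (rule tensor_lift_cong[OF M C MMM \<rho>[OF l]])
        (simp_all add: op23_tens[symmetric] module_hom_mem[OF op23] t Bc m n)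
    also have "\<dots> = op23 K M ?R (op12 K M ?R (?t l m n))"
      unfolding op12_tens[OF l m n]
      by (rule module_hom_tensor_lift[OF M C MMM MMM \<rho>[OF l] op23, symmetric]) (simp add: t n m Bc)
    finally show "op12 K M ?R (op23 K M ?R (?t l m n)) = op23 K M ?R (op12 K M ?R (?t l m n))" .
  qed
  with R show ?thesis by (simp add: solves_D_equation_def)
qed

end
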